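(* For every nontrivial knot type $[K]$, $1+\sqrt{1+c[K]}\le \mathrm{sps}[K]$, where $c[K]$ is the crossing number of $[K]$.
   Context: The crossing number $c[K]$ is the minimum number of crossings in a diagram of $[K]$. A spherical stick diagram of $[K]$ is a closed curve on the 2-sphere formed by finitely many arcs of great circles (not entire great circles) joined end to end, whose self-intersections are transverse double points away from the arc endpoints, with crossing information at each self-intersection, representing $[K]$. For nontrivial $[K]$, $\mathrm{sps}[K]$ is the minimum number of great circle arcs in such a diagram (undefined for the unknot). *)

theory Defs
  imports "HOL-Analysis.Analysis"
begin

type_synonym R3 = "real^3"

definition knot :: "R3 set \<Rightarrow> bool" where
  "knot K \<longleftrightarrow> K homeomorphic (sphere (0::real^2) 1)"

definition ambient_isotopic :: "R3 set \<Rightarrow> R3 set \<Rightarrow> bool" where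
  "ambient_isotopic K L \<longleftrightarrow>
     (\<exists>H :: real \<Rightarrow> R3 \<Rightarrow> R3.
        continuous_on ({0..1} \<times> UNIV) (\<lambda>(t,x). H t x) \<and>
        (\<forall>t\<in>{0..1}. \<exists>g. homeomorphism UNIV UNIV (H t) g) \<and>
        (\<forall>x. H 0 x = x) \<and> H 1 ` K = L)"

definition polygon :: "R3 list \<Rightarrow> R3 set" where
  "polygon vs = (\<Union>i<length vs. closed_segment (vs ! i) (vs ! ((i + 1) mod length vs)))"

definition polygonal_knot :: "R3 list \<Rightarrow> bool" where
  "polygonal_knot vs \<longleftrightarrow> length vs \<ge> 3 \<and> knot (polygon vs)"

definition tame_knot :: "R3 set \<Rightarrow> bool" where
  "tame_knot K \<longleftrightarrow> knot K \<and> (\<exists>vs. polygonal_knot vs \<and> ambient_isotopic K (polygon vs))"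

definition unknot :: "R3 set \<Rightarrow> bool" where
  "unknot K \<longleftrightarrow> ambient_isotopic K {x. x $ 3 = 0 \<and> norm x = 1}"

definition proj :: "R3 \<Rightarrow> real \<times> real" where
  "proj x = (x $ 1, x $ 2)"

definition double_points :: "R3 set \<Rightarrow> (real \<times> real) set" where
  "double_points P = {y. card {x\<in>P. proj x = y} = 2}"

text \<open>Regular projection of a polygonal knot: every fibre has at most two points,
  finitely many double points, and no vertex projects to a double point
  (transversality is then automatic for straight edges).\<close>
definition regular_projection :: "R3 list \<Rightarrow> bool" where
  "regular_projection vs \<longleftrightarrow>
     (\<forall>y. finite {x\<in>polygon vs. proj x = y} \<and> card {x\<in>polygon vs. proj x = y} \<le> 2) \<and>
     finite (double_points (polygon vs)) \<and>
     (\<forall>v\<in>set vs. card {x\<in>polygon vs. proj x = proj v} = 1)"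

definition has_diagram :: "R3 set \<Rightarrow> nat \<Rightarrow> bool" where
  "has_diagram K n \<longleftrightarrow>
     (\<exists>vs. polygonal_knot vs \<and> ambient_isotopic K (polygon vs) \<and>
           regular_projection vs \<and> card (double_points (polygon vs)) = n)"

definition crossing_number :: "R3 set \<Rightarrow> nat" where
  "crossing_number K = (LEAST n. has_diagram K n)"

definition great_arc :: "R3 set \<Rightarrow> bool" where
  "great_arc A \<longleftrightarrow>
     (\<exists>u w \<theta>. norm u = 1 \<and> norm w = 1 \<and> u \<bullet> w = 0 \<and> 0 < \<theta> \<and> \<theta> < 2 * pi \<and>
        A = (\<lambda>s. cos s *\<^sub>R u + sin s *\<^sub>R w) ` {0..\<theta>})"

definition radial :: "R3 \<Rightarrow> R3" where
  "radial x = (1 / norm x) *\<^sub>R x"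

text \<open>A spherical stick diagram with n arcs representing the knot type of K:
  a knot L in the type of K, avoiding the origin, whose radial projection onto the
  unit sphere is a closed curve made of n great-circle arcs joined end to end, with
  only transverse double points, none at arc endpoints. The crossing information is
  given by the distance from the origin.\<close>
definition has_sps_diagram :: "R3 set \<Rightarrow> nat \<Rightarrow> bool" where
  "has_sps_diagram K n \<longleftrightarrow>
    (\<exists>(\<gamma>::real \<Rightarrow> R3) (t::nat \<Rightarrow> real) (A::nat \<Rightarrow> R3 set).
       let L = \<gamma> ` {0..1}; c = radial \<circ> \<gamma> in
       continuous_on {0..1} \<gamma> \<and> \<gamma> 0 = \<gamma> 1 \<and> inj_on \<gamma> {0..<1} \<and>
       0 \<notin> L \<and> ambient_isotopic K L \<and>
       t 0 = 0 \<and> t n = 1 \<and> (\<forall>i<n. t i < t (Suc i)) \<and>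
       (\<forall>i<n. great_arc (A i) \<and> inj_on c {t i..t (Suc i)} \<and> c ` {t i..t (Suc i)} = A i) \<and>
       (\<forall>y. finite {s\<in>{0..<1}. c s = y} \<and> card {s\<in>{0..<1}. c s = y} \<le> 2) \<and>
       finite {y. card {s\<in>{0..<1}. c s = y} = 2} \<and>
       (\<forall>i\<le>n. card {s\<in>{0..<1}. c s = c (t i)} = 1) \<and>
       (\<forall>i<n. \<forall>j<n. \<forall>s\<in>{t i<..<t (Suc i)}. \<forall>s'\<in>{t j<..<t (Suc j)}.
           s \<noteq> s' \<and> c s = c s' \<longrightarrow>
           \<not> (\<exists>N. N \<noteq> 0 \<and> A i \<union> A j \<subseteq> {x. N \<bullet> x = 0})))"

definition sps :: "R3 set \<Rightarrow> nat" where
  "sps K = (LEAST n. has_sps_diagram K n)"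

end

theory Submission
  imports Defs
begin

text \<open>Two great-circle arcs in different planes meet in at most two antipodal points, and if they
  are consecutive then one of these points is their common endpoint, which is not a crossing.
  Summing over the partners of each arc, a spherical diagram with \<open>n\<close> arcs has at most
  \<open>n (n - 2) = (n - 1)\<^sup>2 - 1\<close> crossings. It remains to turn it into a planar polygonal diagram with
  the same crossings. A piecewise linear homeomorphism that maps rays from the origin to rays
  pushes the curve into the upper half space, where central projection to a horizontal plane
  makes every arc polygonal; a rescaling of the horizontal planes makes that projection
  parallel, and a vertical shift straightens the heights. Conversely a tame knot
  has a spherical stick diagram, so that \<open>sps\<close> is the least element of a nonempty set: project a
  polygon radially from a generic point.\<close>

subsection \<open>Ambient isotopies\<close>

text \<open>Central projection is the right chart because it sends great circles to straight lines,
  but it sees only an open hemisphere, while the curve may wind around the whole sphere. Hence the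
  bent map: its folds cost extra vertices but no crossings. The other obstacle is height. Nothing is
  known about how the distance from the origin varies along an arc, so after projection the heights
  are merely continuous and must become affine along edges without strands passing through each
  other; only the heights at crossings matter for this. In the count, each arc has
  \<open>n - 1\<close> partners with at most two common points each, its two ends save one each, and
  every crossing is seen from two arcs: \<open>n\<close> times \<open>2 (n - 2)\<close>, halved.
  Finally, both invariants are least elements of sets of natural numbers: bounding
  \<open>crossing_number\<close> from above takes any one diagram, whereas bounding
  \<open>sps\<close> from below takes a diagram with exactly \<open>sps K\<close> arcs.\<close>

lemma ambient_isotopicI:
  fixes H G :: "real \<Rightarrow> R3 \<Rightarrow> R3"
  assumes cont: "continuous_on ({0..1} \<times> UNIV) (\<lambda>(t,x). H t x)"
    and contG: "\<And>t. t \<in> {0..1} \<Longrightarrow> continuous_on UNIV (G t)"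
    and GH: "\<And>t x. t \<in> {0..1} \<Longrightarrow> G t (H t x) = x"
    and HG: "\<And>t x. t \<in> {0..1} \<Longrightarrow> H t (G t x) = x"
    and H0: "\<And>x. H 0 x = x"
  shows "ambient_isotopic K (H 1 ` K)"
proof -
  have "homeomorphism UNIV UNIV (H t) (G t)" if t: "t \<in> {0..1}" for t
  proof (rule homeomorphismI)
    have "continuous_on UNIV ((\<lambda>(t,x). H t x) \<circ> Pair t)"
      by (rule continuous_on_compose[OF _ continuous_on_subset[OF cont]])
         (use t in \<open>auto intro!: continuous_intros\<close>)
    then show "continuous_on UNIV (H t)" by (simp add: o_def)
  qed (use t contG GH HG in auto)
  then have "\<forall>t\<in>{0..1}. \<exists>g. homeomorphism UNIV UNIV (H t) g" by blast
  with cont H0 show ?thesis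
    unfolding ambient_isotopic_def by blast
qed

lemma ambient_isotopic_trans:
  assumes "ambient_isotopic K L" "ambient_isotopic L M"
  shows "ambient_isotopic K M"
proof -
  obtain F :: "real \<Rightarrow> R3 \<Rightarrow> R3" where F: "continuous_on ({0..1} \<times> UNIV) (\<lambda>(t,x). F t x)"
    "\<And>t. t \<in> {0..1} \<Longrightarrow> \<exists>g. homeomorphism UNIV UNIV (F t) g" "\<And>x. F 0 x = x" "F 1 ` K = L"
    using assms(1) unfolding ambient_isotopic_def by blast
  obtain G :: "real \<Rightarrow> R3 \<Rightarrow> R3" where G: "continuous_on ({0..1} \<times> UNIV) (\<lambda>(t,x). G t x)"
    "\<And>t. t \<in> {0..1} \<Longrightarrow> \<exists>g. homeomorphism UNIV UNIV (G t) g" "\<And>x. G 0 x = x" "G 1 ` L = M"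
    using assms(2) unfolding ambient_isotopic_def by blast
  define H :: "real \<Rightarrow> R3 \<Rightarrow> R3" where "H t x = (if t \<le> 1/2 then F (2*t) x else G (2*t-1) (F 1 x))" for t x
  have F1: "continuous_on UNIV (F 1)"
    using F(2)[of 1] by (auto simp: homeomorphism_def)
  have "continuous_on ({0..1} \<times> UNIV)
      (\<lambda>p. if fst p \<le> 1/2 then F (2 * fst p) (snd p) else G (2 * fst p - 1) (F 1 (snd p)))"
  proof (rule continuous_on_cases_le)
    have "continuous_on {p \<in> {0..1} \<times> UNIV. fst p \<le> 1/2}
        ((\<lambda>(t,x). F t x) \<circ> (\<lambda>p. (2 * fst p, snd p)))"
      by (rule continuous_on_compose[OF _ continuous_on_subset[OF F(1)]])
         (auto intro!: continuous_intros)
    then show "continuous_on {p \<in> {0..1} \<times> UNIV. fst p \<le> 1/2} (\<lambda>p. F (2 * fst p) (snd p))"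
      by (simp add: o_def)
    have "continuous_on {p \<in> {0..1::real} \<times> UNIV. 1/2 \<le> fst p}
        ((\<lambda>(t,x). G t x) \<circ> (\<lambda>p. (2 * fst p - 1, F 1 (snd p))))"
      by (rule continuous_on_compose[OF _ continuous_on_subset[OF G(1)]])
         (auto intro!: continuous_intros continuous_on_compose2[OF F1])
    then show "continuous_on {p \<in> {0..1} \<times> UNIV. 1/2 \<le> fst p}
        (\<lambda>p. G (2 * fst p - 1) (F 1 (snd p)))"
      by (simp add: o_def)
    show "F (2 * fst p) (snd p) = G (2 * fst p - 1) (F 1 (snd p))" if "fst p = 1/2" for p
      by (simp add: that G(3))
  qed (auto intro!: continuous_intros)
  then have "continuous_on ({0..1} \<times> UNIV) (\<lambda>(t,x). H t x)"
    by (simp add: H_def case_prod_unfold)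
  moreover have "\<exists>g. homeomorphism UNIV UNIV (H t) g" if t: "t \<in> {0..1}" for t
  proof (cases "t \<le> 1/2")
    case True
    then have "H t = F (2*t)" by (auto simp: H_def)
    moreover have "\<exists>g. homeomorphism UNIV UNIV (F (2*t)) g" by (rule F(2)) (use True t in auto)
    ultimately show ?thesis by simp
  next
    case False
    then have "H t = G (2*t-1) \<circ> F 1" by (auto simp: H_def)
    moreover obtain f g where "homeomorphism UNIV UNIV (F 1) f"
      "homeomorphism UNIV UNIV (G (2*t-1)) g"
      using F(2)[of 1] G(2)[of "2*t-1"] t False by auto
    ultimately have "homeomorphism UNIV UNIV (H t) (f \<circ> g)"
      using homeomorphism_compose[of UNIV UNIV "F 1" f UNIV "G (2*t-1)" g] by simp
    then show ?thesis by blast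
  qed
  moreover have "H 0 x = x" for x by (simp add: H_def F)
  moreover have "H 1 ` K = M"
  proof -
    have "H 1 = (\<lambda>x. G 1 (F 1 x))" by (auto simp: H_def)
    then show ?thesis using F(4) G(4) by auto
  qed
  ultimately show ?thesis unfolding ambient_isotopic_def by blast
qed

lemma ambient_isotopic_translation: "ambient_isotopic K ((\<lambda>x. x + v) ` K)"
proof -
  have "ambient_isotopic K ((\<lambda>t x. x + t *\<^sub>R v) 1 ` K)"
    by (rule ambient_isotopicI[where H = "\<lambda>t x. x + t *\<^sub>R v" and G = "\<lambda>t x. x - t *\<^sub>R v"])
       (auto intro!: continuous_intros simp: case_prod_unfold)
  then show ?thesis by simp
qed

text \<open>The bound keeps the straight path from the identity to \<open>A\<close> inside the
  invertible maps: if \<open>x + t (A x - x)\<close> vanished with \<open>t\<close> in the unit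
  interval, then \<open>norm x\<close> would be at most \<open>norm (A x - x)\<close>. Invertibility
  alone would also admit reflections, which reverse orientation.\<close>

lemma ambient_isotopic_linear:
  assumes A: "linear A" and near: "\<And>x. x \<noteq> 0 \<Longrightarrow> norm (A x - x) < norm x"
  shows "ambient_isotopic K (A ` K)"
proof -
  define H where "H t x = x + t *\<^sub>R (A x - x)" for t x
  have lin: "linear (H t)" for t
    unfolding H_def using A
    by (auto intro!: linearI simp: linear_add linear_scale algebra_simps)
  have inj: "inj (H t)" if "t \<in> {0..1}" for t
  proof -
    have "x = 0" if "H t x = 0" for x
    proof (rule ccontr)
      assume "x \<noteq> 0"
      have "x = - (t *\<^sub>R (A x - x))" using that by (simp add: H_def add_eq_0_iff)
      then have "norm x = \<bar>t\<bar> * norm (A x - x)" by (metis norm_minus_cancel norm_scaleR)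
      also have "\<dots> \<le> 1 * norm (A x - x)"
        by (rule mult_right_mono) (use \<open>t \<in> {0..1}\<close> in auto)
      finally show False using near[OF \<open>x \<noteq> 0\<close>] by simp
    qed
    then show ?thesis using lin by (simp add: linear_injective_0)
  qed
  define G where "G t = (SOME g. linear g \<and> (\<forall>x. g (H t x) = x) \<and> (\<forall>x. H t (g x) = x))" for t
  have G: "linear (G t)" "G t (H t x) = x" "H t (G t x) = x" if "t \<in> {0..1}" for t x
  proof -
    have "\<exists>g. linear g \<and> (\<forall>x. g (H t x) = x) \<and> (\<forall>x. H t (g x) = x)"
      using linear_injective_isomorphism[OF lin inj[OF that]] by blast
    from someI_ex[OF this, folded G_def]
    show "linear (G t)" "G t (H t x) = x" "H t (G t x) = x" by blast+
  qed
  have contA: "continuous_on UNIV A"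
    using A by (simp add: linear_continuous_on linear_conv_bounded_linear)
  have "ambient_isotopic K (H 1 ` K)"
  proof (rule ambient_isotopicI[where H = H and G = G])
    show "continuous_on ({0..1} \<times> UNIV) (\<lambda>(t,x). H t x)"
      unfolding H_def case_prod_unfold
      by (intro continuous_intros continuous_on_compose2[OF contA]) auto
    show "continuous_on UNIV (G t)" if "t \<in> {0..1}" for t
      using G(1)[OF that] by (simp add: linear_continuous_on linear_conv_bounded_linear)
  qed (simp_all add: G, simp add: H_def)
  moreover have "H 1 = A" by (auto simp: H_def)
  ultimately show ?thesis by simp
qed

section \<open>Plane and height coordinates, and isotopies that preserve one of them\<close>

definition lift :: "real \<times> real \<Rightarrow> real \<Rightarrow> R3" where
  "lift p z = vector [fst p, snd p, z]"

lemma lift_component [simp]: "lift p z $ 1 = fst p" "lift p z $ 2 = snd p" "lift p z $ 3 = z"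
  by (simp_all add: lift_def vector_3)

lemma proj_lift [simp]: "proj (lift p z) = p"
  by (simp add: proj_def)

lemma lift_proj [simp]: "lift (proj x) (x $ 3) = x"
  by (simp add: proj_def vec_eq_iff forall_3)

lemma lift_eq_iff [simp]: "lift p z = lift q w \<longleftrightarrow> p = q \<and> z = w"
  by (auto simp: vec_eq_iff forall_3 prod_eq_iff)

lemma lift_affine: "lift (p + r *\<^sub>R (q - p)) (z + r * (w - z)) = lift p z + r *\<^sub>R (lift q w - lift p z)"
  by (auto simp: vec_eq_iff forall_3)

lemma continuous_on_lift [continuous_intros]:
  assumes "continuous_on S f" "continuous_on S g"
  shows "continuous_on S (\<lambda>x. lift (f x) (g x))"
proof -
  have "lift (f x) (g x) = (\<chi> i. if i = 1 then fst (f x) else if i = 2 then snd (f x) else g x)" for x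
    by (auto simp: vec_eq_iff forall_3)
  moreover have "continuous_on S (\<lambda>x. if i = 1 then fst (f x) else if i = 2 then snd (f x) else g x)"
    for i :: 3
    using assms by (cases "i = 1"; cases "i = 2") (auto intro!: continuous_intros)
  ultimately show ?thesis
    by (simp add: continuous_on_vec_lambda)
qed

lemma continuous_on_proj [continuous_intros]:
  "continuous_on S f \<Longrightarrow> continuous_on S (\<lambda>x. proj (f x))"
  unfolding proj_def by (intro continuous_intros)

text \<open>The shift depends only on \<open>proj x\<close>, which it does not change, so
  subtracting the same amount inverts it at every time.\<close>

lemma ambient_isotopic_vertical_shift:
  assumes d: "continuous_on UNIV d"
  shows "ambient_isotopic K ((\<lambda>x. lift (proj x) (x $ 3 + d (proj x))) ` K)"
proof -
  have cd: "continuous_on S (\<lambda>x. d (f x))" if "continuous_on S f" for f and S :: "'b::topological_space set"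
    using continuous_on_compose2[OF d that] by auto
  have "ambient_isotopic K ((\<lambda>t x. lift (proj x) (x $ 3 + t * d (proj x))) 1 ` K)"
    by (rule ambient_isotopicI[where H = "\<lambda>t x. lift (proj x) (x $ 3 + t * d (proj x))"
        and G = "\<lambda>t x. lift (proj x) (x $ 3 - t * d (proj x))"])
       (auto intro!: continuous_intros cd simp: case_prod_unfold)
  then show ?thesis by simp
qed

text \<open>At time \<open>t\<close> the plane at height \<open>z\<close> is scaled by a convex
  combination of 1 and \<open>f z\<close>, which is positive. The height is preserved, so the
  reciprocal factor inverts the map.\<close>

lemma ambient_isotopic_horizontal_scaling:
  assumes f: "continuous_on UNIV f" and pos: "\<And>z. 0 < f z"
  shows "ambient_isotopic K ((\<lambda>x. lift (f (x $ 3) *\<^sub>R proj x) (x $ 3)) ` K)"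
proof -
  have cf: "continuous_on S (\<lambda>x. f (h x))" if "continuous_on S h" for h and S :: "'b::topological_space set"
    using continuous_on_compose2[OF f that] by auto
  define g where "g t z = (1 - t) + t * f z" for t z
  have g: "0 < g t z" if "t \<in> {0..1}" for t z
    using that pos[of z] unfolding g_def
    by (cases "t = 0") (auto intro!: add_nonneg_pos)
  have "ambient_isotopic K ((\<lambda>t x. lift (g t (x $ 3) *\<^sub>R proj x) (x $ 3)) 1 ` K)"
  proof (rule ambient_isotopicI[where H = "\<lambda>t x. lift (g t (x $ 3) *\<^sub>R proj x) (x $ 3)"
        and G = "\<lambda>t x. lift ((1 / g t (x $ 3)) *\<^sub>R proj x) (x $ 3)"])
    show "continuous_on ({0..1} \<times> UNIV) (\<lambda>(t, x). lift (g t (x $ 3) *\<^sub>R proj x) (x $ 3))"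
      unfolding g_def case_prod_unfold by (intro continuous_intros cf)
    show "continuous_on UNIV (\<lambda>x. lift ((1 / g t (x $ 3)) *\<^sub>R proj x) (x $ 3))"
      if "t \<in> {0..1}" for t
    proof -
      have "g t z \<noteq> 0" for z using g[OF that, of z] by simp
      then show ?thesis
        unfolding g_def by (intro continuous_intros cf) auto
    qed
  next
    fix t :: real and x :: R3 assume t: "t \<in> {0..1}"
    have "g t (x $ 3) \<noteq> 0" using g[OF t, of "x $ 3"] by simp
    then show "lift ((1 / g t (lift (g t (x $ 3) *\<^sub>R proj x) (x $ 3) $ 3)) *\<^sub>R
        proj (lift (g t (x $ 3) *\<^sub>R proj x) (x $ 3))) (lift (g t (x $ 3) *\<^sub>R proj x) (x $ 3) $ 3) = x"
      and "lift (g t (lift ((1 / g t (x $ 3)) *\<^sub>R proj x) (x $ 3) $ 3) *\<^sub>R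
        proj (lift ((1 / g t (x $ 3)) *\<^sub>R proj x) (x $ 3))) (lift ((1 / g t (x $ 3)) *\<^sub>R proj x) (x $ 3) $ 3) = x"
      by simp_all
  qed (simp add: g_def)
  then show ?thesis by (simp add: g_def)
qed

subsection \<open>Simple loops made of segments\<close>

text \<open>A continuous injective path in a line runs monotonically along a segment, at whatever
  speed. \<open>l\<close> is its affine coordinate, read off by the inner product with the chord and
  normalised to 0 and 1 at the ends.\<close>

lemma injective_collinear_param:
  fixes f :: "real \<Rightarrow> 'a::euclidean_space"
  assumes ab: "a < b" and cont: "continuous_on {a..b} f" and inj: "inj_on f {a..b}"
    and line: "\<And>s. s \<in> {a..b} \<Longrightarrow> \<exists>r. f s = p + r *\<^sub>R d"
  obtains l where "continuous_on {a..b} l" "l a = 0" "l b = 1" "l ` {a..b} = {0..1}"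
    "\<And>s. s \<in> {a..b} \<Longrightarrow> f s = f a + l s *\<^sub>R (f b - f a)"
proof -
  have ne: "f b \<noteq> f a" using inj_onD[OF inj, of a b] ab by auto
  define e where "e = f b - f a"
  define l where "l s = ((f s - f a) \<bullet> e) / (e \<bullet> e)" for s
  have e: "e \<noteq> 0" "e \<bullet> e \<noteq> 0" using ne by (auto simp: e_def)
  obtain ra rb where r: "f a = p + ra *\<^sub>R d" "f b = p + rb *\<^sub>R d"
    using line[of a] line[of b] ab by auto
  have ed: "e = (rb - ra) *\<^sub>R d" by (simp add: e_def r algebra_simps)
  then have rab: "rb - ra \<noteq> 0" using e by auto
  have fl: "f s = f a + l s *\<^sub>R e" if "s \<in> {a..b}" for s
  proof -
    obtain r where "f s = p + r *\<^sub>R d" using line[OF \<open>s \<in> {a..b}\<close>] by auto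
    moreover have "((r - ra) / (rb - ra)) *\<^sub>R e = (r - ra) *\<^sub>R d"
      using rab by (simp add: ed)
    ultimately have "f s - f a = ((r - ra) / (rb - ra)) *\<^sub>R e"
      by (simp add: r algebra_simps)
    moreover from this have "l s = (r - ra) / (rb - ra)" using e by (simp add: l_def)
    ultimately have "f s - f a = l s *\<^sub>R e" by simp
    then show ?thesis by (simp add: algebra_simps)
  qed
  have cl: "continuous_on {a..b} l" unfolding l_def using e by (intro continuous_intros cont) auto
  have il: "inj_on l {a..b}"
  proof (rule inj_onI)
    fix x y assume "x \<in> {a..b}" "y \<in> {a..b}" "l x = l y"
    then show "x = y" using fl[of x] fl[of y] by (intro inj_onD[OF inj]) simp_all
  qed
  have l0: "l a = 0" and l1: "l b = 1" using e by (simp_all add: l_def e_def)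
  have "l ` closed_segment a b = closed_segment (l a) (l b)"
    by (rule continuous_injective_image_segment_1)
       (use cl il ab in \<open>auto simp: closed_segment_eq_real_ivl\<close>)
  then have "l ` {a..b} = {0..1}" using ab l0 l1 by (simp add: closed_segment_eq_real_ivl)
  then show thesis by (rule that[OF cl l0 l1 _ fl[unfolded e_def]])
qed

lemma image_eq_closed_segment:
  assumes "l ` S = {0..1::real}" "\<And>s. s \<in> S \<Longrightarrow> f s = p + l s *\<^sub>R (q - p)"
  shows "f ` S = closed_segment p q"
proof -
  have "f ` S = (\<lambda>r. p + r *\<^sub>R (q - p)) ` (l ` S)"
    using assms(2) by (simp add: image_image cong: image_cong)
  also have "\<dots> = closed_segment p q"
    unfolding assms(1) closed_segment_image_interval by (rule image_cong) (auto simp: algebra_simps)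
  finally show ?thesis .
qed

lemma knot_simple_loop:
  fixes W :: "real \<Rightarrow> R3"
  assumes "continuous_on {0..1} W" "W 0 = W 1" "inj_on W {0..<1}"
  shows "knot (W ` {0..1})"
proof -
  have "simple_path W"
  proof
    show "path W" using assms by (simp add: path_def)
    fix x y :: real assume xy: "0 \<le> x" "x < y" "y \<le> 1" "W x = W y"
    show "x = 0 \<and> y = 1"
    proof (cases "y = 1")
      case True
      then show ?thesis using inj_onD[OF assms(3), of x 0] xy assms(2) by auto
    next
      case False
      then show ?thesis using inj_onD[OF assms(3), of x y] xy by auto
    qed
  qed
  then have "path_image W homeomorphic sphere (0::complex) 1"
    using homeomorphic_simple_path_image_circle[of W 1 0] assms(2)
    by (auto simp: pathfinish_def pathstart_def)
  also have "sphere (0::complex) 1 homeomorphic sphere (0::real^2) 1"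
    by (rule homeomorphic_spheres_gen) auto
  finally show ?thesis unfolding knot_def path_image_def .
qed

text \<open>The homeomorphism hidden in \<open>knot\<close> is composed with
  \<open>cis (2 * pi * s)\<close>, which runs once around the circle. This is the converse of
  \<open>knot_simple_loop\<close>.\<close>

lemma knot_loop_param:
  assumes "knot P"
  obtains W :: "real \<Rightarrow> R3" where "continuous_on {0..1} W" "W 0 = W 1" "inj_on W {0..<1}" "W ` {0..1} = P"
proof -
  have "sphere (0::complex) 1 homeomorphic sphere (0::real^2) 1"
    by (rule homeomorphic_spheres_gen) auto
  then have "sphere (0::complex) 1 homeomorphic P"
    using assms unfolding knot_def by (meson homeomorphic_sym homeomorphic_trans)
  then obtain f g where "homeomorphism (sphere (0::complex) 1) P f g"
    unfolding homeomorphic_def by auto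
  then have f: "continuous_on (sphere 0 1) f" "f ` sphere 0 1 = P" "inj_on f (sphere 0 1)"
    unfolding homeomorphism_def by (auto intro: inj_on_inverseI)
  define W where "W s = f (cis (2 * pi * s))" for s :: real
  have im: "(\<lambda>s. cis (2 * pi * s)) ` {0..1} = sphere 0 1"
  proof (intro equalityI subsetI)
    fix z :: complex assume "z \<in> sphere 0 1"
    then have z: "z = cis (Arg2pi z)" using Arg2pi_eq[of z] by (simp add: cis_conv_exp)
    have "0 \<le> Arg2pi z" "Arg2pi z < 2 * pi" using Arg2pi_ge_0 Arg2pi_lt_2pi by auto
    then show "z \<in> (\<lambda>s. cis (2 * pi * s)) ` {0..1}"
      by (intro image_eqI[of _ _ "Arg2pi z / (2 * pi)"]) (use z in auto)
  qed auto
  have inj: "inj_on (\<lambda>s. cis (2 * pi * s)) {0..<1}"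
  proof (rule inj_onI)
    fix x y :: real assume xy: "x \<in> {0..<1}" "y \<in> {0..<1}" "cis (2*pi*x) = cis (2*pi*y)"
    then have "sin (2*pi*x) = sin (2*pi*y) \<and> cos (2*pi*x) = cos (2*pi*y)"
      by (simp add: complex_eq_iff)
    then obtain n :: int where "2*pi*x = 2*pi*y + 2*pi*n"
      unfolding sin_cos_eq_iff by auto
    then have "2*pi*x = 2*pi*(y + n)" by (simp add: algebra_simps)
    then have "x = y + n" by simp
    then have "\<bar>real_of_int n\<bar> < 1" using xy by auto
    then have "n = 0" by linarith
    then show "x = y" using \<open>x = y + n\<close> by simp
  qed
  show thesis
  proof (rule that[of W])
    show "continuous_on {0..1} W"
      unfolding W_def by (rule continuous_on_compose2[OF f(1)]) (auto intro!: continuous_intros)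
    show "W 0 = W 1" by (simp add: W_def)
    show "inj_on W {0..<1}"
    proof (rule inj_onI)
      fix x y assume xy: "x \<in> {0..<1}" "y \<in> {0..<1}" "W x = W y"
      then have "cis (2 * pi * x) = cis (2 * pi * y)"
        unfolding W_def by (intro inj_onD[OF f(3)]) auto
      with xy show "x = y" by (intro inj_onD[OF inj])
    qed
    have "W ` {0..1} = f ` (\<lambda>s. cis (2 * pi * s)) ` {0..1}"
      unfolding W_def image_image ..
    then show "W ` {0..1} = P" unfolding im f(2) .
  qed
qed

section \<open>Partitions of the parameter interval\<close>

lemma partition_strict_mono:
  fixes t :: "nat \<Rightarrow> real"
  assumes "\<And>k. k < m \<Longrightarrow> t k < t (Suc k)" "i < j" "j \<le> m"
  shows "t i < t j"
  using assms(2,3)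
proof (induction j)
  case (Suc j)
  show ?case
  proof (cases "i = j")
    case False
    then have "t i < t j" using Suc by simp
    also have "t j < t (Suc j)" using assms(1) Suc.prems by simp
    finally show ?thesis .
  qed (use assms(1) Suc.prems in simp)
qed simp

lemma partition_cover:
  fixes t :: "nat \<Rightarrow> real"
  assumes "t 0 \<le> s" "s \<le> t m" "0 < m"
  obtains k where "k < m" "t k \<le> s" "s \<le> t (Suc k)"
proof -
  have "\<exists>k<m. t k \<le> s \<and> s \<le> t (Suc k)"
    using assms(3,2)
  proof (induction m rule: nat_induct_non_zero)
    case 1
    then show ?case using assms(1) by auto
  next
    case (Suc m)
    show ?case
    proof (cases "s \<le> t m")
      case True
      then show ?thesis using Suc.IH less_SucI by blast
    qed (use Suc.prems in auto)
  qed
  then show thesis using that by blast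
qed

lemma partition_enumeration:
  fixes V :: "real set"
  assumes "finite V" "V \<subseteq> {0..1}" "0 \<in> V" "1 \<in> V"
  obtains m \<sigma> where "\<sigma> 0 = 0" "\<sigma> m = 1" "\<And>k. k < m \<Longrightarrow> \<sigma> k < \<sigma> (Suc k)"
    "V = \<sigma> ` {..m}" "\<And>k. k < m \<Longrightarrow> {\<sigma> k<..<\<sigma> (Suc k)} \<inter> V = {}"
proof -
  define xs where "xs = sorted_list_of_set V"
  define m where "m = length xs - 1"
  have set: "set xs = V" and st: "sorted xs" "distinct xs"
    using assms by (auto simp: xs_def)
  have len: "length xs = Suc m" using assms(3) set by (cases xs) (auto simp: m_def)
  have mono: "xs ! i < xs ! j" if "i < j" "j \<le> m" for i j
    using sorted_wrt_nth_less[of "(<)" xs i j] st that len by (simp add: strict_sorted_iff)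
  have V: "V = (\<lambda>i. xs ! i) ` {..m}"
    using set len by (auto simp: set_conv_nth less_Suc_eq_le)
  have le: "xs ! 0 \<le> xs ! i" "xs ! i \<le> xs ! m" if "i \<le> m" for i
    using mono[of 0 i] mono[of i m] that by (cases "i = 0"; cases "i = m"; force)+
  show thesis
  proof (rule that[of "\<lambda>i. xs ! i" m])
    obtain i where "i \<le> m" "xs ! i = 0" using V assms(3) by auto
    then have "xs ! 0 \<le> 0" using le(1)[of i] by simp
    moreover have "xs ! 0 \<in> V" unfolding V by simp
    ultimately show "xs ! 0 = 0" using assms(2) by force
    obtain i where "i \<le> m" "xs ! i = 1" using V assms(4) by auto
    then have "1 \<le> xs ! m" using le(2)[of i] by simp
    moreover have "xs ! m \<in> V" unfolding V by simp
    ultimately show "xs ! m = 1" using assms(2) by force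
    show "xs ! k < xs ! Suc k" if "k < m" for k using mono[of k "Suc k"] that by simp
    show "V = (\<lambda>i. xs ! i) ` {..m}" by (rule V)
    show "{xs ! k<..<xs ! Suc k} \<inter> V = {}" if "k < m" for k
    proof -
      have "xs ! i \<le> xs ! k \<or> xs ! Suc k \<le> xs ! i" if "i \<le> m" for i
        using mono[of i k] mono[of "Suc k" i] \<open>k < m\<close> that
        by (cases "i < k"; cases "i = k"; cases "i = Suc k") auto
      then show ?thesis unfolding V by force
    qed
  qed
qed

text \<open>Only the values at interior breakpoints have to match. It serves to assemble a height
  function that is prescribed edge by edge.\<close>

lemma continuous_glue_pieces:
  fixes \<sigma> :: "nat \<Rightarrow> real" and f :: "nat \<Rightarrow> real \<Rightarrow> real"
  assumes mono: "\<And>k. k < m \<Longrightarrow> \<sigma> k < \<sigma> (Suc k)"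
    and cont: "\<And>k. k < m \<Longrightarrow> continuous_on {\<sigma> k..\<sigma> (Suc k)} (f k)"
    and agree: "\<And>k. Suc k < m \<Longrightarrow> f k (\<sigma> (Suc k)) = f (Suc k) (\<sigma> (Suc k))"
    and "0 < m"
  obtains g where "continuous_on {\<sigma> 0..\<sigma> m} g"
    "\<And>k s. k < m \<Longrightarrow> s \<in> {\<sigma> k..\<sigma> (Suc k)} \<Longrightarrow> g s = f k s"
proof -
  have "\<exists>g. continuous_on {\<sigma> 0..\<sigma> m} g \<and> (\<forall>k<m. \<forall>s\<in>{\<sigma> k..\<sigma> (Suc k)}. g s = f k s)"
    using \<open>0 < m\<close> mono cont agree
  proof (induction m rule: nat_induct_non_zero)
    case 1
    then show ?case by (intro exI[of _ "f 0"]) auto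
  next
    case (Suc m)
    obtain g where g: "continuous_on {\<sigma> 0..\<sigma> m} g"
      "\<And>k s. k < m \<Longrightarrow> s \<in> {\<sigma> k..\<sigma> (Suc k)} \<Longrightarrow> g s = f k s"
    proof -
      have "\<exists>g. continuous_on {\<sigma> 0..\<sigma> m} g \<and> (\<forall>k<m. \<forall>s\<in>{\<sigma> k..\<sigma> (Suc k)}. g s = f k s)"
        by (rule Suc.IH) (simp_all add: Suc.prems)
      then show thesis using that by blast
    qed
    define h where "h s = (if s \<le> \<sigma> m then g s else f m s)" for s
    obtain k where k: "m = Suc k" using \<open>0 < m\<close> by (cases m) auto
    have mid: "g (\<sigma> m) = f m (\<sigma> m)"
    proof -
      have "g (\<sigma> m) = f k (\<sigma> m)" using g(2)[of k "\<sigma> m"] k Suc.prems(1)[of k] by auto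
      then show ?thesis using Suc.prems(3)[of k] k by simp
    qed
    have lt: "\<sigma> i < \<sigma> j" if "i < j" "j \<le> Suc m" for i j
      using partition_strict_mono[of "Suc m" \<sigma> i j] Suc.prems(1) that by blast
    have "continuous_on {\<sigma> 0..\<sigma> (Suc m)} h"
      unfolding h_def
    proof (rule continuous_on_cases_le)
      show "continuous_on {x \<in> {\<sigma> 0..\<sigma> (Suc m)}. x \<le> \<sigma> m} g"
        by (rule continuous_on_subset[OF g(1)]) auto
      show "continuous_on {x \<in> {\<sigma> 0..\<sigma> (Suc m)}. \<sigma> m \<le> x} (f m)"
        by (rule continuous_on_subset[OF Suc.prems(2)[of m]]) auto
    qed (use mid in \<open>auto intro: continuous_on_id\<close>)
    moreover have "h s = f k s" if "k < Suc m" "s \<in> {\<sigma> k..\<sigma> (Suc k)}" for k s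
    proof (cases "k = m")
      case True
      then show ?thesis using that mid by (cases "s = \<sigma> m") (auto simp: h_def)
    next
      case False
      then have "\<sigma> (Suc k) \<le> \<sigma> m" using lt[of "Suc k" m] that by (cases "Suc k = m") auto
      then show ?thesis using that g(2)[of k s] False by (auto simp: h_def)
    qed
    ultimately show ?case by blast
  qed
  then show thesis using that by blast
qed

subsection \<open>Diagrams of polygonal plane curves\<close>

text \<open>A vertical shift of the ambient space can replace the height function by any other one
  that agrees with it at the crossings, since the difference is then a function of the
  projected point.\<close>
lemma ambient_isotopic_change_heights:
  fixes u :: "real \<Rightarrow> real \<times> real" and z z' :: "real \<Rightarrow> real"
  assumes cu: "continuous_on {0..1} u" and cz: "continuous_on {0..1} z"
    and cz': "continuous_on {0..1} z'"
    and eq: "\<And>s s'. s \<in> {0..1} \<Longrightarrow> s' \<in> {0..1} \<Longrightarrow> u s = u s' \<Longrightarrow> z' s - z s = z' s' - z s'"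
  shows "ambient_isotopic ((\<lambda>s. lift (u s) (z s)) ` {0..1}) ((\<lambda>s. lift (u s) (z' s)) ` {0..1})"
proof -
  define pre where "pre y = (SOME s. s \<in> {0..1} \<and> u s = y)" for y
  define d where "d y = z' (pre y) - z (pre y)" for y
  have d: "d (u s) = z' s - z s" if "s \<in> {0..1}" for s
  proof -
    have "pre (u s) \<in> {0..1} \<and> u (pre (u s)) = u s"
      unfolding pre_def by (rule someI[of _ s]) (use that in auto)
    then show ?thesis unfolding d_def using eq that by blast
  qed
  \<comment> \<open>The graph of \<open>d\<close> over the curve is a continuous image of the
    interval, hence compact. This makes \<open>d\<close> continuous even where the curve meets
    itself, and Tietze extends it to the plane.\<close>
  have "(\<lambda>y. (y, d y)) ` u ` {0..1} = (\<lambda>s. (u s, z' s - z s)) ` {0..1}"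
    using d by (auto simp: image_image)
  moreover have "compact ((\<lambda>s. (u s, z' s - z s)) ` {0..1})"
    by (intro compact_continuous_image continuous_intros assms compact_Icc)
  ultimately have "closed ((\<lambda>y. (y, d y)) ` u ` {0..1})" by (simp add: compact_imp_closed)
  moreover have "d \<in> u ` {0..1} \<rightarrow> (\<lambda>s. z' s - z s) ` {0..1}" using d by auto
  moreover have "compact ((\<lambda>s. z' s - z s) ` {0..1})"
    by (intro compact_continuous_image continuous_intros assms compact_Icc)
  ultimately have "continuous_on (u ` {0..1}) d" by (intro continuous_from_closed_graph)
  moreover have "compact (u ` {0..1})"
    by (intro compact_continuous_image cu compact_Icc)
  then have "closedin (top_of_set UNIV) (u ` {0..1})" by (simp add: compact_imp_closed)
  ultimately obtain e where e: "continuous_on UNIV e" "\<And>y. y \<in> u ` {0..1} \<Longrightarrow> e y = d y"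
    by (rule Tietze_unbounded) (rule that)
  have im: "(\<lambda>x. lift (proj x) (x $ 3 + e (proj x))) ` (\<lambda>s. lift (u s) (z s)) ` {0..1}
      = (\<lambda>s. lift (u s) (z' s)) ` {0..1}"
    unfolding image_image by (rule image_cong) (use e(2) d in auto)
  from ambient_isotopic_vertical_shift[OF e(1), of "(\<lambda>s. lift (u s) (z s)) ` {0..1}"]
  show ?thesis unfolding im .
qed

lemma finite_set_gap:
  fixes F :: "real set"
  assumes "finite F"
  obtains \<delta> where "0 < \<delta>" "\<And>x y. x \<in> F \<Longrightarrow> y \<in> F \<Longrightarrow> x \<noteq> y \<Longrightarrow> 2 * \<delta> < \<bar>x - y\<bar>"
proof -
  \<comment> \<open>The element 1 keeps the minimum defined when \<open>F\<close> has fewer than two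
    points. A third of the minimum leaves strictly more than \<open>2 * \<delta>\<close> between
    distinct points.\<close>
  define D where "D = insert 1 ((\<lambda>(x,y). \<bar>x - y\<bar>) ` {p \<in> F \<times> F. fst p \<noteq> snd p})"
  have D: "finite D" "D \<noteq> {}" "\<And>d. d \<in> D \<Longrightarrow> 0 < d" using assms by (auto simp: D_def)
  then have pos: "0 < Min D" by simp
  have "2 * (Min D / 3) < \<bar>x - y\<bar>" if "x \<in> F" "y \<in> F" "x \<noteq> y" for x y
  proof -
    have "\<bar>x - y\<bar> \<in> D" using that unfolding D_def by force
    then have "Min D \<le> \<bar>x - y\<bar>" using D by simp
    then show ?thesis using pos by linarith
  qed
  with pos that[of "Min D / 3"] show thesis by simp
qed

text \<open>Heights matter only at the parameters in \<open>X\<close>, where two strands meet.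
  Vertices are inserted at distance \<open>\<delta>\<close> on both sides of each such
  \<open>x\<close>, and both get the height \<open>z x\<close>: the short edge through the crossing
  is then level at the right height, while the remaining vertices can be put at height 0. The
  polygon lies over the same plane curve and agrees with the given knot at the crossings, so a
  vertical isotopy relates the two.\<close>

lemma planar_curve_diagram:
  fixes u :: "real \<Rightarrow> real \<times> real" and z :: "real \<Rightarrow> real"
  defines "X \<equiv> {s\<in>{0..<1}. \<exists>s'\<in>{0..<1}. s' \<noteq> s \<and> u s' = u s}"
  assumes cu: "continuous_on {0..1} u" and cz: "continuous_on {0..1} z"
    and loop: "u 0 = u 1" "z 0 = z 1"
    and inj: "inj_on (\<lambda>s. lift (u s) (z s)) {0..<1}"
    and fin: "\<And>y. finite {s\<in>{0..<1}. u s = y}" and le2: "\<And>y. card {s\<in>{0..<1}. u s = y} \<le> 2"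
    and fin2: "finite {y. card {s\<in>{0..<1}. u s = y} = 2}"
    and finX: "finite X"
    and B: "finite B" "B \<subseteq> {0..1}" "0 \<in> B" "1 \<in> B" "B \<inter> X = {}"
    and seg: "\<And>a b. 0 \<le> a \<Longrightarrow> a < b \<Longrightarrow> b \<le> 1 \<Longrightarrow> {a<..<b} \<inter> B = {} \<Longrightarrow>
      inj_on u {a..b} \<and> (\<exists>p d. \<forall>s\<in>{a..b}. \<exists>r. u s = p + r *\<^sub>R d)"
  shows "has_diagram ((\<lambda>s. lift (u s) (z s)) ` {0..1}) (card {y. card {s\<in>{0..<1}. u s = y} = 2})"
proof -
  have "infinite ({0<..<1::real} - X)" using finX by (simp add: infinite_Ioo)
  \<comment> \<open>Two more breakpoints off the crossings: with 0 and 1 they make four points,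
    hence at least the three edges that \<open>polygonal_knot\<close> demands.\<close>
  then obtain E where E: "finite E" "card E = 2" "E \<subseteq> {0<..<1} - X"
    using infinite_arbitrarily_large by blast
  define B1 where "B1 = B \<union> E"
  have B1: "finite B1" "B1 \<subseteq> {0..1}" "0 \<in> B1" "1 \<in> B1" "B1 \<inter> X = {}"
    using B E by (auto simp: B1_def)
  obtain \<delta> where \<delta>: "0 < \<delta>" "\<And>x y. x \<in> B1 \<union> X \<Longrightarrow> y \<in> B1 \<union> X \<Longrightarrow> x \<noteq> y \<Longrightarrow> 2 * \<delta> < \<bar>x - y\<bar>"
    using finite_set_gap[of "B1 \<union> X"] B1 finX by blast
  define V where "V = B1 \<union> (\<lambda>x. x - \<delta>) ` X \<union> (\<lambda>x. x + \<delta>) ` X"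
  have X01: "2 * \<delta> < x" "x < 1 - 2 * \<delta>" if "x \<in> X" for x
  proof -
    have "x \<noteq> 0" "x \<noteq> 1" "0 \<le> x" "x < 1" using that B1 by (auto simp: X_def)
    then show "2 * \<delta> < x" "x < 1 - 2 * \<delta>" using \<delta>(2)[of x 0] \<delta>(2)[of x 1] B1 that by auto
  qed
  have V: "finite V" "V \<subseteq> {0..1}" "0 \<in> V" "1 \<in> V"
  proof -
    show "finite V" "0 \<in> V" "1 \<in> V" using B1 finX by (auto simp: V_def)
    have "x - \<delta> \<in> {0..1}" "x + \<delta> \<in> {0..1}" if "x \<in> X" for x
      using X01[OF that] \<delta>(1) by auto
    then show "V \<subseteq> {0..1}" using B1(2) by (auto simp only: V_def)
  qed
  have VX: "V \<inter> X = {}"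
  proof -
    have "x - \<delta> \<notin> X" "x + \<delta> \<notin> X" if "x \<in> X" for x
    proof -
      show "x - \<delta> \<notin> X"
      proof
        assume "x - \<delta> \<in> X"
        then show False using \<delta>(2)[of x "x - \<delta>"] that \<delta>(1) by simp
      qed
      show "x + \<delta> \<notin> X"
      proof
        assume "x + \<delta> \<in> X"
        then show False using \<delta>(2)[of x "x + \<delta>"] that \<delta>(1) by simp
      qed
    qed
    then show ?thesis using B1(5) unfolding V_def by blast
  qed
  obtain m \<sigma> where \<sigma>: "\<sigma> 0 = 0" "\<sigma> m = 1" "\<And>k. k < m \<Longrightarrow> \<sigma> k < \<sigma> (Suc k)"
    "V = \<sigma> ` {..m}" "\<And>k. k < m \<Longrightarrow> {\<sigma> k<..<\<sigma> (Suc k)} \<inter> V = {}"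
    by (rule partition_enumeration[OF V]) (rule that)
  have m: "3 \<le> m"
  proof -
    have "0 \<notin> E" "1 \<notin> E" using E(3) by auto
    then have "card ({0,1} \<union> E) = 4" using E(1,2) by simp
    moreover have "E \<subseteq> V" unfolding V_def B1_def by blast
    then have "card ({0,1} \<union> E) \<le> card V" using V(3,4) by (intro card_mono V(1)) blast
    ultimately have "4 \<le> card V" by simp
    also have "card V \<le> Suc m" unfolding \<sigma>(4) using card_image_le[of "{..m}" \<sigma>] by simp
    finally show ?thesis by simp
  qed
  have \<sigma>01: "0 \<le> \<sigma> k" "\<sigma> k \<le> 1" if "k \<le> m" for k
    using V(2) \<sigma>(4) that by auto
  \<comment> \<open>The description is unambiguous because the intervals of radius
    \<open>\<delta>\<close> around points of \<open>X\<close> are disjoint. The default 0 applies at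
    both ends of the loop, so the polygon closes up.\<close>
  define \<zeta> where "\<zeta> s = (if \<exists>x\<in>X. \<bar>s - x\<bar> \<le> \<delta> then z (THE x. x \<in> X \<and> \<bar>s - x\<bar> \<le> \<delta>) else 0)" for s
  have \<zeta>: "\<zeta> s = z x" if "x \<in> X" "\<bar>s - x\<bar> \<le> \<delta>" for s x
  proof -
    have "y = x" if "y \<in> X" "\<bar>s - y\<bar> \<le> \<delta>" for y
    proof (rule ccontr)
      assume "y \<noteq> x"
      then have "2 * \<delta> < \<bar>x - y\<bar>" using \<delta>(2)[of x y] \<open>x \<in> X\<close> \<open>y \<in> X\<close> by blast
      then show False using \<open>\<bar>s - x\<bar> \<le> \<delta>\<close> \<open>\<bar>s - y\<bar> \<le> \<delta>\<close> by linarith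
    qed
    with that have "(THE x. x \<in> X \<and> \<bar>s - x\<bar> \<le> \<delta>) = x"
      by (intro the_equality) blast+
    moreover have "\<exists>x\<in>X. \<bar>s - x\<bar> \<le> \<delta>" using that by blast
    ultimately show ?thesis unfolding \<zeta>_def by simp
  qed
  have \<zeta>01: "\<zeta> 0 = 0" "\<zeta> 1 = 0"
  proof -
    have "\<not> \<bar>0 - x\<bar> \<le> \<delta>" "\<not> \<bar>1 - x\<bar> \<le> \<delta>" if "x \<in> X" for x
      using X01[OF that] \<delta>(1) by auto
    then show "\<zeta> 0 = 0" "\<zeta> 1 = 0" unfolding \<zeta>_def by meson+
  qed
  define w where "w s = lift (u s) (\<zeta> s)" for s
  have w01: "w 0 = w 1" by (simp add: w_def loop \<zeta>01)
  have "\<exists>l. continuous_on {\<sigma> k..\<sigma> (Suc k)} l \<and> l (\<sigma> k) = 0 \<and> l (\<sigma> (Suc k)) = 1 \<and>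
      l ` {\<sigma> k..\<sigma> (Suc k)} = {0..1} \<and>
      (\<forall>s\<in>{\<sigma> k..\<sigma> (Suc k)}. u s = u (\<sigma> k) + l s *\<^sub>R (u (\<sigma> (Suc k)) - u (\<sigma> k)))"
    if "k < m" for k
  proof -
    have B0: "{\<sigma> k<..<\<sigma> (Suc k)} \<inter> B = {}"
      using \<sigma>(5)[OF that] unfolding V_def B1_def by blast
    have k01: "0 \<le> \<sigma> k" "\<sigma> (Suc k) \<le> 1"
      using \<sigma>01(1)[of k] \<sigma>01(2)[of "Suc k"] that by auto
    from seg[OF k01(1) \<sigma>(3)[OF that] k01(2) B0]
    obtain p d where inju: "inj_on u {\<sigma> k..\<sigma> (Suc k)}"
      and pd: "\<And>s. s \<in> {\<sigma> k..\<sigma> (Suc k)} \<Longrightarrow> \<exists>r. u s = p + r *\<^sub>R d"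
      by blast
    have contu: "continuous_on {\<sigma> k..\<sigma> (Suc k)} u"
      by (rule continuous_on_subset[OF cu]) (use k01 in auto)
    show ?thesis
    proof (rule injective_collinear_param[OF \<sigma>(3)[OF that] contu inju pd])
      fix l assume "continuous_on {\<sigma> k..\<sigma> (Suc k)} l" "l (\<sigma> k) = 0" "l (\<sigma> (Suc k)) = 1"
        "l ` {\<sigma> k..\<sigma> (Suc k)} = {0..1}"
        "\<And>s. s \<in> {\<sigma> k..\<sigma> (Suc k)} \<Longrightarrow> u s = u (\<sigma> k) + l s *\<^sub>R (u (\<sigma> (Suc k)) - u (\<sigma> k))"
      then show ?thesis by blast
    qed
  qed
  then obtain l where l: "\<And>k. k < m \<Longrightarrow> continuous_on {\<sigma> k..\<sigma> (Suc k)} (l k)"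
    "\<And>k. k < m \<Longrightarrow> l k (\<sigma> k) = 0" "\<And>k. k < m \<Longrightarrow> l k (\<sigma> (Suc k)) = 1"
    "\<And>k. k < m \<Longrightarrow> l k ` {\<sigma> k..\<sigma> (Suc k)} = {0..1}"
    "\<And>k s. k < m \<Longrightarrow> s \<in> {\<sigma> k..\<sigma> (Suc k)} \<Longrightarrow> u s = u (\<sigma> k) + l k s *\<^sub>R (u (\<sigma> (Suc k)) - u (\<sigma> k))"
    by metis
  \<comment> \<open>The interpolation uses the position \<open>l k s\<close> on the edge and not the
    parameter \<open>s\<close>, so that planar point and height together trace a straight segment
    even if \<open>u\<close> moves at varying speed.\<close>
  define f where "f k s = \<zeta> (\<sigma> k) + l k s * (\<zeta> (\<sigma> (Suc k)) - \<zeta> (\<sigma> k))" for k s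
  have "\<exists>g. continuous_on {\<sigma> 0..\<sigma> m} g \<and> (\<forall>k<m. \<forall>s\<in>{\<sigma> k..\<sigma> (Suc k)}. g s = f k s)"
  proof (rule continuous_glue_pieces[of m \<sigma> f])
    show "continuous_on {\<sigma> k..\<sigma> (Suc k)} (f k)" if "k < m" for k
      unfolding f_def by (intro continuous_intros l that)
    show "f k (\<sigma> (Suc k)) = f (Suc k) (\<sigma> (Suc k))" if "Suc k < m" for k
      using l(2)[of "Suc k"] l(3)[of k] that by (simp add: f_def)
  qed (use \<sigma>(3) m in auto)
  then obtain z' where z': "continuous_on {0..1} z'"
    "\<And>k s. k < m \<Longrightarrow> s \<in> {\<sigma> k..\<sigma> (Suc k)} \<Longrightarrow> z' s = f k s"
    using \<sigma>(1,2) by auto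
  define W where "W s = lift (u s) (z' s)" for s
  have Wseg: "W ` {\<sigma> k..\<sigma> (Suc k)} = closed_segment (w (\<sigma> k)) (w (\<sigma> (Suc k)))" if "k < m" for k
  proof (rule image_eq_closed_segment[OF l(4)[OF that]])
    fix s assume s: "s \<in> {\<sigma> k..\<sigma> (Suc k)}"
    have "W s = lift (u (\<sigma> k) + l k s *\<^sub>R (u (\<sigma> (Suc k)) - u (\<sigma> k))) (f k s)"
      using l(5)[OF that s] z'(2)[OF that s] by (simp add: W_def)
    then show "W s = w (\<sigma> k) + l k s *\<^sub>R (w (\<sigma> (Suc k)) - w (\<sigma> k))"
      by (simp add: w_def f_def lift_affine)
  qed
  have Ww: "W (\<sigma> k) = w (\<sigma> k)" if "k < m" for k
    using z'(2)[OF that, of "\<sigma> k"] l(2)[OF that] \<sigma>(3)[OF that] by (simp add: W_def w_def f_def)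
  have zX: "z' x = z x" if "x \<in> X" for x
  proof -
    have "0 \<le> x" "x \<le> 1" using that by (auto simp: X_def)
    then obtain k where k: "k < m" "\<sigma> k \<le> x" "x \<le> \<sigma> (Suc k)"
      using partition_cover[of \<sigma> x m] \<sigma>(1,2) m by auto
    \<comment> \<open>Since \<open>x - \<delta>\<close> and \<open>x + \<delta>\<close> are
      breakpoints, the piece containing \<open>x\<close> does not extend beyond them, and
      \<open>\<zeta>\<close> equals \<open>z x\<close> at both its ends.\<close>
    have "x - \<delta> \<in> V" "x + \<delta> \<in> V" using that by (auto simp: V_def)
    then have "x - \<delta> \<notin> {\<sigma> k<..<\<sigma> (Suc k)}" "x + \<delta> \<notin> {\<sigma> k<..<\<sigma> (Suc k)}"
      using \<sigma>(5)[OF k(1)] by blast+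
    then have "x - \<delta> \<le> \<sigma> k" "\<sigma> (Suc k) \<le> x + \<delta>" using k \<delta>(1) by auto
    then have "\<bar>\<sigma> k - x\<bar> \<le> \<delta>" "\<bar>\<sigma> (Suc k) - x\<bar> \<le> \<delta>" using k by auto
    then have "f k x = z x" using \<zeta>[OF that] by (simp add: f_def)
    then show ?thesis using z'(2)[OF k(1), of x] k by simp
  qed
  have z'01: "z' 0 = 0" "z' 1 = 0"
  proof -
    show "z' 0 = 0" using Ww[of 0] m by (simp add: W_def w_def \<sigma>(1) \<zeta>01)
    obtain k where k: "m = Suc k" using m by (cases m) auto
    then have "z' 1 = f k 1" using z'(2)[of k 1] \<sigma>(2) \<sigma>(3)[of k] by auto
    also have "\<dots> = 0" using l(3)[of k] \<sigma>(2) k by (simp add: f_def \<zeta>01)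
    finally show "z' 1 = 0" .
  qed
  have Wcont: "continuous_on {0..1} W"
    unfolding W_def by (intro continuous_intros cu z')
  have Wloop: "W 0 = W 1" by (simp add: W_def loop z'01)
  have Winj: "inj_on W {0..<1}"
  proof (rule inj_onI, rule ccontr)
    \<comment> \<open>Two parameters with the same new point would form a crossing, and there the
      new heights are the old ones, which differ.\<close>
    fix x y assume xy: "x \<in> {0..<1}" "y \<in> {0..<1}" "W x = W y" "x \<noteq> y"
    then have e: "u x = u y" "z' x = z' y" by (auto simp: W_def)
    then have "x \<in> X" "y \<in> X" using xy by (auto simp: X_def)
    then have "lift (u x) (z x) = lift (u y) (z y)" using e zX by simp
    then show False using inj_onD[OF inj] xy by blast
  qed
  define vs where "vs = map (\<lambda>k. w (\<sigma> k)) [0..<m]"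
  have poly: "polygon vs = W ` {0..1}"
  proof -
    have "vs ! ((i + 1) mod length vs) = w (\<sigma> (Suc i))" if "i < m" for i
      using that w01 \<sigma>(1,2) by (cases "Suc i = m") (auto simp: vs_def)
    then have "polygon vs = (\<Union>i<m. closed_segment (w (\<sigma> i)) (w (\<sigma> (Suc i))))"
      unfolding polygon_def by (intro SUP_cong) (auto simp: vs_def)
    also have "\<dots> = (\<Union>i<m. W ` {\<sigma> i..\<sigma> (Suc i)})" using Wseg by simp
    also have "\<dots> = W ` (\<Union>i<m. {\<sigma> i..\<sigma> (Suc i)})" by blast
    also have "(\<Union>i<m. {\<sigma> i..\<sigma> (Suc i)}) = {0..1}"
    proof (intro equalityI subsetI)
      fix s :: real assume "s \<in> {0..1}"
      then show "s \<in> (\<Union>i<m. {\<sigma> i..\<sigma> (Suc i)})"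
        using partition_cover[of \<sigma> s m] \<sigma>(1,2) m by force
    next
      fix s assume "s \<in> (\<Union>i<m. {\<sigma> i..\<sigma> (Suc i)})"
      then obtain i where "i < m" "\<sigma> i \<le> s" "s \<le> \<sigma> (Suc i)" by auto
      then show "s \<in> {0..1}" using \<sigma>01[of i] \<sigma>01[of "Suc i"] by auto
    qed
    finally show ?thesis .
  qed
  have "W ` {0..1} = W ` {0..<1}"
  proof -
    have "{0..1} = insert 1 {0..<1::real}" by auto
    moreover have "W 1 \<in> W ` {0..<1}" by (rule image_eqI[of _ _ 0]) (use Wloop in auto)
    ultimately show ?thesis by (simp only: image_insert insert_absorb)
  qed
  then have fib: "{x \<in> polygon vs. proj x = y} = W ` {s\<in>{0..<1}. u s = y}" for y
    unfolding poly by (auto simp: W_def)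
  have card_fib: "card {x \<in> polygon vs. proj x = y} = card {s\<in>{0..<1}. u s = y}" for y
    unfolding fib by (intro card_image inj_on_subset[OF Winj]) auto
  have "polygonal_knot vs"
    unfolding polygonal_knot_def poly
    using knot_simple_loop[OF Wcont Wloop Winj] m by (simp add: vs_def)
  moreover have "ambient_isotopic ((\<lambda>s. lift (u s) (z s)) ` {0..1}) (polygon vs)"
    unfolding poly W_def
  proof (rule ambient_isotopic_change_heights[OF cu cz z'(1)])
    \<comment> \<open>The parameters 0 and 1 give the same point, but \<open>X\<close> records only
      parameters below 1; \<open>h\<close> moves 1 to 0.\<close>
    define h where "h s = (if s = 1 then 0 else s)" for s :: real
    have h: "h s \<in> {0..<1}" "u (h s) = u s" "z' (h s) - z (h s) = z' s - z s" if "s \<in> {0..1}" for s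
      using that loop z'01 by (auto simp: h_def)
    fix s s' :: real assume s: "s \<in> {0..1}" "s' \<in> {0..1}" "u s = u s'"
    have "z' (h s) - z (h s) = z' (h s') - z (h s')"
    proof (cases "h s = h s'")
      case False
      have "u (h s) = u (h s')" using h(2) s by simp
      then have "h s \<in> X" "h s' \<in> X"
        unfolding X_def using h(1)[OF s(1)] h(1)[OF s(2)] False by (auto intro: bexI[of _ "h s"] bexI[of _ "h s'"])
      then show ?thesis using zX by simp
    qed simp
    then show "z' s - z s = z' s' - z s'" using h s by simp
  qed
  moreover have "double_points (polygon vs) = {y. card {s\<in>{0..<1}. u s = y} = 2}"
    unfolding double_points_def card_fib ..
  moreover have "regular_projection vs"
    unfolding regular_projection_def
  proof (intro conjI allI ballI)
    show "finite {x \<in> polygon vs. proj x = y}" for y unfolding fib using fin by simp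
    show "card {x \<in> polygon vs. proj x = y} \<le> 2" for y unfolding card_fib by (rule le2)
    show "finite (double_points (polygon vs))" unfolding double_points_def card_fib by (rule fin2)
    fix v assume "v \<in> set vs"
    then obtain k where k: "k < m" "v = w (\<sigma> k)" by (auto simp: vs_def)
    have "\<sigma> k \<in> {0..<1}"
      using partition_strict_mono[of m \<sigma> k m] \<sigma> k \<sigma>01[of k] by auto
    moreover have "\<sigma> k \<in> V" unfolding \<sigma>(4) using k(1) by simp
    then have "\<sigma> k \<notin> X" using VX by blast
    ultimately have "{s\<in>{0..<1}. u s = proj v} = {\<sigma> k}"
      by (auto simp: k w_def X_def)
    then show "card {x \<in> polygon vs. proj x = proj v} = 1" unfolding card_fib by simp
  qed
  ultimately show ?thesis unfolding has_diagram_def by metis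
qed

lemma has_diagram_isotopic:
  "ambient_isotopic K L \<Longrightarrow> has_diagram L m \<Longrightarrow> has_diagram K m"
  unfolding has_diagram_def using ambient_isotopic_trans by blast

subsection \<open>Crossings of great-circle arcs\<close>

lemma norm_radial: "x \<noteq> 0 \<Longrightarrow> norm (radial x) = 1"
  by (simp add: radial_def)

lemma inner_radial_eq_0_iff: "x \<noteq> 0 \<Longrightarrow> N \<bullet> radial x = 0 \<longleftrightarrow> N \<bullet> x = 0"
  by (simp add: radial_def)

lemma radial_eq_iff:
  assumes "x \<noteq> 0" "y \<noteq> 0"
  shows "radial x = radial y \<longleftrightarrow> (\<exists>r>0. y = r *\<^sub>R x)"
proof
  assume eq: "radial x = radial y"
  have "y = norm y *\<^sub>R radial y" using assms by (simp add: radial_def)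
  also have "\<dots> = (norm y / norm x) *\<^sub>R x" unfolding eq[symmetric] by (simp add: radial_def)
  finally show "\<exists>r>0. y = r *\<^sub>R x" using assms by (intro exI[of _ "norm y / norm x"]) simp
next
  assume "\<exists>r>0. y = r *\<^sub>R x"
  then show "radial x = radial y" by (auto simp: radial_def)
qed

text \<open>Expanding the triple product of \<open>y\<close> with \<open>cross3 N M\<close> leaves
  two terms, each with one of the vanishing inner products; so \<open>y\<close> is parallel to
  \<open>cross3 N M\<close>.\<close>

lemma orthogonal_to_two:
  fixes N M y :: R3
  assumes "cross3 N M \<noteq> 0" "N \<bullet> y = 0" "M \<bullet> y = 0"
  obtains r where "y = r *\<^sub>R cross3 N M"
proof -
  have "cross3 (cross3 N M) y = 0"
    using assms(2,3) Lagrange[of y N M] cross_skew[of y "cross3 N M"] by (simp add: inner_commute)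
  then have "collinear {0, cross3 N M, y}" by (simp add: cross_eq_0)
  then show thesis using that assms(1) by (auto simp: collinear_lemma)
qed

lemma two_great_circles:
  fixes N M :: R3
  assumes "cross3 N M \<noteq> 0"
  shows "finite {y. norm y = 1 \<and> N \<bullet> y = 0 \<and> M \<bullet> y = 0}"
    and "card {y. norm y = 1 \<and> N \<bullet> y = 0 \<and> M \<bullet> y = 0} \<le> 2"
proof -
  define w where "w = cross3 N M"
  have "{y. norm y = 1 \<and> N \<bullet> y = 0 \<and> M \<bullet> y = 0} \<subseteq> {(1 / norm w) *\<^sub>R w, (- 1 / norm w) *\<^sub>R w}"
  proof
    fix y assume "y \<in> {y. norm y = 1 \<and> N \<bullet> y = 0 \<and> M \<bullet> y = 0}"
    then have y: "norm y = 1" "N \<bullet> y = 0" "M \<bullet> y = 0" by auto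
    obtain r where r: "y = r *\<^sub>R w" using orthogonal_to_two[OF assms y(2,3)] w_def by blast
    then have "\<bar>r\<bar> = 1 / norm w" using y(1) assms by (auto simp: field_simps w_def)
    then have "r = 1 / norm w \<or> r = - 1 / norm w" by linarith
    then show "y \<in> {(1 / norm w) *\<^sub>R w, (- 1 / norm w) *\<^sub>R w}" unfolding r by blast
  qed
  note sub = this
  have "card {(1 / norm w) *\<^sub>R w, (- 1 / norm w) *\<^sub>R w} \<le> 2" by (simp add: card_insert_if)
  with card_mono[OF _ sub] show "card {y. norm y = 1 \<and> N \<bullet> y = 0 \<and> M \<bullet> y = 0} \<le> 2" by simp
  show "finite {y. norm y = 1 \<and> N \<bullet> y = 0 \<and> M \<bullet> y = 0}" by (rule finite_subset[OF sub]) simp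
qed

text \<open>Finitely many hyperplanes have measure zero and cannot cover a ball. Closeness to
  \<open>a\<close> is kept so that a linear map with such rows can be close to the identity.\<close>

lemma generic_vector:
  fixes a :: "'a::euclidean_space"
  assumes "finite F" "0 \<notin> F" "0 < e"
  obtains b where "norm (b - a) < e" "\<And>f. f \<in> F \<Longrightarrow> b \<bullet> f \<noteq> 0"
proof -
  have "negligible (\<Union>f\<in>F. {x. f \<bullet> x = 0})"
    using assms by (intro negligible_Union) (auto intro!: negligible_hyperplane)
  moreover have "\<not> negligible (ball a e)" using assms(3) by (simp add: open_not_negligible)
  ultimately have "\<not> ball a e \<subseteq> (\<Union>f\<in>F. {x. f \<bullet> x = 0})" using negligible_subset by blast
  then obtain b where "b \<in> ball a e" "b \<notin> (\<Union>f\<in>F. {x. f \<bullet> x = 0})" by blast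
  then show thesis using that[of b] by (auto simp: dist_norm norm_minus_commute inner_commute)
qed

lemma great_arc_plane:
  assumes "great_arc A"
  obtains N where "N \<noteq> 0" "\<And>x. x \<in> A \<Longrightarrow> N \<bullet> x = 0"
proof -
  obtain u w \<theta> where uw: "norm u = 1" "norm w = 1" "u \<bullet> w = 0"
    and A: "A = (\<lambda>s. cos s *\<^sub>R u + sin s *\<^sub>R w) ` {0..\<theta>}"
    using assms unfolding great_arc_def by blast
  have "cross3 u w \<noteq> 0" using norm_cross_dot[of u w] uw by auto
  moreover have "cross3 u w \<bullet> x = 0" if "x \<in> A" for x
    using that unfolding A by (auto simp: inner_add_right dot_cross_self)
  ultimately show thesis by (rule that)
qed

text \<open>Translates the transversality clause of \<open>has_sps_diagram\<close>, which forbids a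
  common plane, into independence of normals: parallel normals would have one orthogonal plane
  containing both arcs.\<close>

lemma transversal_normals:
  fixes N M :: R3
  assumes "N \<noteq> 0" "M \<noteq> 0" "\<And>x. x \<in> A \<Longrightarrow> N \<bullet> x = 0" "\<And>x. x \<in> A' \<Longrightarrow> M \<bullet> x = 0"
    and "\<not> (\<exists>N. N \<noteq> 0 \<and> A \<union> A' \<subseteq> {x. N \<bullet> x = 0})"
  shows "cross3 N M \<noteq> 0"
proof
  assume "cross3 N M = 0"
  then obtain r where "M = r *\<^sub>R N" using assms(1) by (auto simp: cross_eq_0 collinear_lemma)
  then have "A \<union> A' \<subseteq> {x. N \<bullet> x = 0}" using assms by auto
  then show False using assms by blast
qed

text \<open>Double counting of pairs of a crossing and an arc through it. Since \<open>c\<close> is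
  injective on each arc, the two strands of a crossing lie on different arcs, so every crossing is
  counted at least twice, while each arc is counted at most \<open>2 * (n - 2)\<close>
  times.\<close>

lemma spherical_crossings_bound:
  fixes c :: "real \<Rightarrow> R3" and t :: "nat \<Rightarrow> real" and N :: "nat \<Rightarrow> R3"
  defines "D \<equiv> {y. card {s\<in>{0..<1}. c s = y} = 2}"
  assumes t: "t 0 = 0" "t n = 1" "\<And>i. i < n \<Longrightarrow> t i < t (Suc i)" and loop: "c 0 = c 1"
    and unit: "\<And>s. s \<in> {0..1} \<Longrightarrow> norm (c s) = 1"
    and plane: "\<And>i s. i < n \<Longrightarrow> s \<in> {t i..t (Suc i)} \<Longrightarrow> N i \<bullet> c s = 0"
    and inj: "\<And>i. i < n \<Longrightarrow> inj_on c {t i..t (Suc i)}"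
    and fin: "finite D"
    and single: "\<And>i. i \<le> n \<Longrightarrow> card {s\<in>{0..<1}. c s = c (t i)} = 1"
    and trans: "\<And>i j s s'. i < n \<Longrightarrow> j < n \<Longrightarrow> s \<in> {t i<..<t (Suc i)} \<Longrightarrow> s' \<in> {t j<..<t (Suc j)} \<Longrightarrow>
      s \<noteq> s' \<Longrightarrow> c s = c s' \<Longrightarrow> cross3 (N i) (N j) \<noteq> 0"
  shows "2 \<le> n" and "card D \<le> n * (n - 2)"
proof -
  show n2: "2 \<le> n"
  proof (rule ccontr)
    assume "\<not> 2 \<le> n"
    moreover have "n \<noteq> 0" using t(1,2) by (cases n) auto
    ultimately have "n = 1" by simp
    then have "inj_on c {0..1}" using inj[of 0] t by simp
    then show False using inj_onD[of c "{0..1}" 0 1] loop by auto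
  qed
  have tlt: "t i < t j" if "i < j" "j \<le> n" for i j
    using partition_strict_mono[of n t i j] t(3) that by blast
  have t01: "0 \<le> t i" if "i \<le> n" for i
    using tlt[of 0 i] that t(1) by (cases "i = 0") auto
  have t1: "t i < 1" if "i < n" for i
    using tlt[of i n] that t(2) by simp
  have t1': "t i \<le> 1" if "i \<le> n" for i
    using tlt[of i n] that t(2) by (cases "i = n") auto
  define Y where "Y i = {y \<in> D. \<exists>s\<in>{t i<..<t (Suc i)}. c s = y}" for i
  have vertex: "c (t i) \<notin> D" if "i \<le> n" for i
    using single[OF that] by (simp add: D_def)
  have open_piece: "\<exists>i<n. s \<in> {t i<..<t (Suc i)}" if s: "s \<in> {0..<1}" "c s \<in> D" for s
  proof -
    obtain i where i: "i < n" "t i \<le> s" "s \<le> t (Suc i)"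
      using partition_cover[of t s n] s t n2 by auto
    moreover have "s \<noteq> t i" "s \<noteq> t (Suc i)"
      using vertex[of i] vertex[of "Suc i"] i(1) s(2) by auto
    ultimately show ?thesis by force
  qed
  have two: "\<exists>i<n. \<exists>j<n. i \<noteq> j \<and> y \<in> Y i \<and> y \<in> Y j" if y: "y \<in> D" for y
  proof -
    have "card {s\<in>{0..<1}. c s = y} = 2" using y by (simp add: D_def)
    then obtain s s' where "{s\<in>{0..<1}. c s = y} = {s, s'}" "s \<noteq> s'" by (auto simp: card_2_iff)
    then have s: "s \<in> {0..<1}" "s' \<in> {0..<1}" "c s = y" "c s' = y" "s \<noteq> s'" by blast+
    obtain i where i: "i < n" "s \<in> {t i<..<t (Suc i)}" using open_piece[of s] s y by auto
    obtain j where j: "j < n" "s' \<in> {t j<..<t (Suc j)}" using open_piece[of s'] s y by auto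
    have "i \<noteq> j"
    proof
      assume "i = j"
      then show False using inj_onD[OF inj[OF i(1)], of s s'] s i j by auto
    qed
    then show ?thesis using i j s y unfolding Y_def by blast
  qed
  \<comment> \<open>The first indicator marks the end of arc \<open>i\<close> at which
    \<open>j\<close> starts, the second the end of \<open>j\<close> at which \<open>i\<close>
    starts. Each such vertex uses up one of the two intersection points of the great circles. Both
    indicators are 1 when \<open>n = 2\<close>, where the arcs share both ends.\<close>
  have pair: "card (Y i \<inter> Y j) + ((if j = Suc i mod n then 1 else 0) + (if i = Suc j mod n then 1 else 0)) \<le> 2"
    if ij: "i < n" "j < n" "i \<noteq> j" for i j
  proof (cases "Y i \<inter> Y j = {}")
    case False
    then obtain y where "y \<in> Y i" "y \<in> Y j" by blast
    then obtain s s' where y: "s \<in> {t i<..<t (Suc i)}" "s' \<in> {t j<..<t (Suc j)}" "c s = y" "c s' = y"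
      unfolding Y_def by blast
    have "s \<noteq> s'"
    proof
      assume "s = s'"
      then have "t i < t (Suc j)" "t j < t (Suc i)" using y by auto
      then have "\<not> Suc j \<le> i" "\<not> Suc i \<le> j"
        using tlt[of "Suc j" i] tlt[of "Suc i" j] ij by (auto simp: le_less)
      with ij show False by simp
    qed
    then have cross: "cross3 (N i) (N j) \<noteq> 0" using trans[OF ij(1,2) y(1,2)] y by simp
    define S where "S = {y. norm y = 1 \<and> N i \<bullet> y = 0 \<and> N j \<bullet> y = 0}"
    have S: "finite S" "card S \<le> 2" unfolding S_def using two_great_circles[OF cross] by auto
    define P where "P = (if j = Suc i mod n then {c (t j)} else {}) \<union> (if i = Suc j mod n then {c (t i)} else {})"
    have start: "N k \<bullet> c (t k) = 0" "norm (c (t k)) = 1" if "k < n" for k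
      using plane[OF that, of "t k"] t(3)[OF that] unit[of "t k"] t01[of k] t1[of k] that by auto
    have stop: "N k \<bullet> c (t (Suc k mod n)) = 0" if "k < n" for k
    proof -
      have "c (t (Suc k mod n)) = c (t (Suc k))"
        using that loop t by (cases "Suc k = n") auto
      then show ?thesis using plane[OF that, of "t (Suc k)"] t(3)[OF that] by simp
    qed
    have "P \<subseteq> S" using start[OF ij(1)] start[OF ij(2)] stop[OF ij(1)] stop[OF ij(2)]
      by (auto simp: P_def S_def)
    have "Y i \<inter> Y j \<subseteq> S - P"
    proof
      fix x assume x: "x \<in> Y i \<inter> Y j"
      have "\<exists>r\<in>{t i<..<t (Suc i)}. c r = x" "\<exists>r\<in>{t j<..<t (Suc j)}. c r = x"
        using x unfolding Y_def by blast+
      then obtain r r' where r: "r \<in> {t i<..<t (Suc i)}" "c r = x" "r' \<in> {t j<..<t (Suc j)}" "c r' = x"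
        by blast
      have "x \<in> D" using x unfolding Y_def by blast
      have "N i \<bullet> x = 0" "N j \<bullet> x = 0" using plane[OF ij(1), of r] plane[OF ij(2), of r'] r by auto
      moreover have "norm x = 1"
        using r unit[of r] t01[of i] t1'[of "Suc i"] ij by auto
      moreover have "x \<notin> P" using \<open>x \<in> D\<close> vertex[of i] vertex[of j] ij by (auto simp: P_def)
      ultimately show "x \<in> S - P" by (simp add: S_def)
    qed
    then have "card (Y i \<inter> Y j) \<le> card (S - P)" using S by (intro card_mono) auto
    also have "\<dots> = card S - card P" using S \<open>P \<subseteq> S\<close> by (intro card_Diff_subset) (auto intro: finite_subset)
    finally have le: "card (Y i \<inter> Y j) + card P \<le> 2" using S(2) card_mono[OF S(1) \<open>P \<subseteq> S\<close>] by linarith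
    \<comment> \<open>Needed for \<open>P\<close> to have two elements when both indicators are 1.
      It holds because the value at a vertex is taken only once.\<close>
    have "c (t i) \<noteq> c (t j)"
    proof
      assume eq: "c (t i) = c (t j)"
      obtain a where a: "{s\<in>{0..<1}. c s = c (t i)} = {a}"
        using single[of i] ij by (auto simp: card_1_singleton_iff)
      have "t i \<in> {s\<in>{0..<1}. c s = c (t i)}" "t j \<in> {s\<in>{0..<1}. c s = c (t i)}"
        using eq t01[of i] t01[of j] t1[of i] t1[of j] ij by auto
      then have "t i = t j" unfolding a by simp
      then show False using tlt[of i j] tlt[of j i] ij by (cases "i < j") auto
    qed
    then have "card P = (if j = Suc i mod n then 1 else 0) + (if i = Suc j mod n then 1 else 0)"
      by (auto simp: P_def)
    with le show ?thesis by simp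
  qed simp
  have Ycard: "card (Y i) \<le> 2 * (n - 2)" if i: "i < n" for i
  proof -
    define J where "J = {..<n} - {i}"
    define a b :: "nat \<Rightarrow> nat" where "a j = (if j = Suc i mod n then 1 else 0)"
      and "b j = (if i = Suc j mod n then 1 else 0)" for j
    have J: "finite J" "card J = n - 1" using i by (auto simp: J_def)
    have "Y i \<subseteq> (\<Union>j\<in>J. Y i \<inter> Y j)"
    proof
      fix y assume "y \<in> Y i"
      then have "y \<in> D" by (simp add: Y_def)
      from two[OF this] obtain j where "j < n" "j \<noteq> i" "y \<in> Y j" by metis
      with \<open>y \<in> Y i\<close> show "y \<in> (\<Union>j\<in>J. Y i \<inter> Y j)" by (auto simp: J_def)
    qed
    moreover have "finite (Y k)" for k using fin by (simp add: Y_def)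
    ultimately have "card (Y i) \<le> card (\<Union>j\<in>J. Y i \<inter> Y j)" using J by (intro card_mono) auto
    also have "\<dots> \<le> (\<Sum>j\<in>J. card (Y i \<inter> Y j))" by (rule card_UN_le[OF J(1)])
    finally have 1: "card (Y i) \<le> (\<Sum>j\<in>J. card (Y i \<inter> Y j))" .
    have "(\<Sum>j\<in>J. card (Y i \<inter> Y j) + (a j + b j)) \<le> (\<Sum>j\<in>J. 2)"
      unfolding a_def b_def by (intro sum_mono pair) (use i in \<open>auto simp: J_def\<close>)
    then have 2: "(\<Sum>j\<in>J. card (Y i \<inter> Y j)) + (sum a J + sum b J) \<le> 2 * (n - 1)"
      using J by (simp add: sum.distrib)
    \<comment> \<open>\<open>p\<close> is the arc after \<open>i\<close> and \<open>q\<close> the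
      one before it; each saves one intersection. For \<open>n = 2\<close> they coincide, but
      \<open>a\<close> and \<open>b\<close> still contribute separately.\<close>
    define p q where "p = Suc i mod n" and "q = (if i = 0 then n - 1 else i - 1)"
    have "p \<in> J" using i n2 by (cases "Suc i = n") (auto simp: p_def J_def)
    then have "a p \<le> sum a J" using J(1) by (intro member_le_sum) auto
    moreover have "q \<in> J" using i n2 by (auto simp: q_def J_def)
    then have "b q \<le> sum b J" using J(1) by (intro member_le_sum) auto
    moreover have "a p = 1" by (simp add: a_def p_def)
    moreover have "b q = 1" using i n2 by (auto simp: b_def q_def)
    ultimately show ?thesis using 1 2 by linarith
  qed
  have "2 * card D = (\<Sum>y\<in>D. 2)" by simp
  also have "\<dots> \<le> (\<Sum>y\<in>D. card {i \<in> {..<n}. y \<in> Y i})"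
  proof (rule sum_mono)
    fix y assume "y \<in> D"
    then obtain i j where ij: "i < n" "j < n" "i \<noteq> j" "y \<in> Y i" "y \<in> Y j" using two by blast
    then have "card {i, j} \<le> card {i \<in> {..<n}. y \<in> Y i}" by (intro card_mono) auto
    then show "2 \<le> card {i \<in> {..<n}. y \<in> Y i}" using ij(3) by simp
  qed
  also have "\<dots> = (\<Sum>i<n. card {y \<in> D. y \<in> Y i})"
    by (rule sum_multicount_gen[symmetric]) (use fin in auto)
  also have "\<dots> = (\<Sum>i<n. card (Y i))" by (intro sum.cong arg_cong[of _ _ card]) (auto simp: Y_def)
  also have "\<dots> \<le> (\<Sum>i<n. 2 * (n - 2))" by (intro sum_mono Ycard) auto
  finally show "card D \<le> n * (n - 2)" by simp
qed

text \<open>Two maps with the same fibres on \<open>S\<close> differ by the bijection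
  \<open>h\<close> between their values, so multiplicities and the number of double values transfer.
  It carries the crossings of the spherical curve over to its planar image.\<close>

lemma double_values_cong:
  assumes eq: "\<And>s s'. s \<in> S \<Longrightarrow> s' \<in> S \<Longrightarrow> u s = u s' \<longleftrightarrow> c s = c s'"
    and fin: "\<And>y. finite {s\<in>S. c s = y}" and le2: "\<And>y. card {s\<in>S. c s = y} \<le> 2"
    and fin2: "finite {y. card {s\<in>S. c s = y} = 2}"
  shows "finite {s\<in>S. u s = x}" and "card {s\<in>S. u s = x} \<le> 2"
    and "finite {x. card {s\<in>S. u s = x} = 2}"
    and "card {x. card {s\<in>S. u s = x} = 2} = card {y. card {s\<in>S. c s = y} = 2}"
proof -
  have fib: "{s\<in>S. u s = u a} = {s\<in>S. c s = c a}" if "a \<in> S" for a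
    using eq that by blast
  show "finite {s\<in>S. u s = x}"
  proof (cases "\<exists>a\<in>S. u a = x")
    case True
    then obtain a where "a \<in> S" "u a = x" by blast
    then show ?thesis using fib[of a] fin[of "c a"] by simp
  next
    case False
    then have "{s\<in>S. u s = x} = {}" by blast
    then show ?thesis by (simp only: finite.emptyI)
  qed
  show "card {s\<in>S. u s = x} \<le> 2"
  proof (cases "\<exists>a\<in>S. u a = x")
    case True
    then obtain a where "a \<in> S" "u a = x" by blast
    then show ?thesis using fib[of a] le2[of "c a"] by simp
  next
    case False
    then have "{s\<in>S. u s = x} = {}" by blast
    then show ?thesis by (simp only: card.empty)
  qed
  define h where "h y = u (inv_into S c y)" for y
  have h: "h (c a) = u a" if "a \<in> S" for a
  proof -
    have "inv_into S c (c a) \<in> S" "c (inv_into S c (c a)) = c a"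
      using that by (auto intro: inv_into_into f_inv_into_f)
    then show ?thesis unfolding h_def using eq that by blast
  qed
  have nonempty: "\<exists>a\<in>S. f a = y" if "card {s\<in>S. f s = y} = 2" for f :: "'a \<Rightarrow> 'd" and y
  proof (rule ccontr)
    assume "\<not> (\<exists>a\<in>S. f a = y)"
    then have "{s\<in>S. f s = y} = {}" by blast
    then have "card {s\<in>S. f s = y} = 0" by (simp only: card.empty)
    with that show False by linarith
  qed
  have "bij_betw h {y. card {s\<in>S. c s = y} = 2} {x. card {s\<in>S. u s = x} = 2}"
  proof (rule bij_betw_imageI)
    show "inj_on h {y. card {s\<in>S. c s = y} = 2}"
    proof (rule inj_onI)
      fix y y' assume "y \<in> {y. card {s\<in>S. c s = y} = 2}" "y' \<in> {y. card {s\<in>S. c s = y} = 2}" "h y = h y'"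
      moreover from this obtain a a' where "a \<in> S" "c a = y" "a' \<in> S" "c a' = y'"
        using nonempty[of c] by blast
      ultimately show "y = y'" using h[of a] h[of a'] eq[of a a'] by simp
    qed
    show "h ` {y. card {s\<in>S. c s = y} = 2} = {x. card {s\<in>S. u s = x} = 2}"
    proof (intro equalityI subsetI)
      fix x assume "x \<in> h ` {y. card {s\<in>S. c s = y} = 2}"
      then obtain y where y: "x = h y" "card {s\<in>S. c s = y} = 2" by blast
      then obtain a where "a \<in> S" "c a = y" using nonempty[of c] by blast
      then show "x \<in> {x. card {s\<in>S. u s = x} = 2}" using y fib[of a] h[of a] by simp
    next
      fix x assume "x \<in> {x. card {s\<in>S. u s = x} = 2}"
      then have x: "card {s\<in>S. u s = x} = 2" by simp
      then obtain a where "a \<in> S" "u a = x" using nonempty[of u] by blast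
      then show "x \<in> h ` {y. card {s\<in>S. c s = y} = 2}"
        using x fib[of a] h[of a] by (intro image_eqI[of _ _ "c a"]) auto
    qed
  qed
  then show "finite {x. card {s\<in>S. u s = x} = 2}"
    and "card {x. card {s\<in>S. u s = x} = 2} = card {y. card {s\<in>S. c s = y} = 2}"
    using fin2 by (simp_all add: bij_betw_finite bij_betw_same_card)
qed

subsection \<open>From spherical to planar diagrams\<close>

text \<open>The base point is the foot of the perpendicular from the origin, and
  \<open>(- q, p)\<close> is the direction of the line.\<close>

lemma affine_line_param:
  fixes p q r :: real
  assumes "p \<noteq> 0 \<or> q \<noteq> 0" "p * fst v + q * snd v = r"
  shows "\<exists>k. v = (p * r / (p\<^sup>2 + q\<^sup>2), q * r / (p\<^sup>2 + q\<^sup>2)) + k *\<^sub>R (- q, p)"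
proof -
  have pos: "p\<^sup>2 + q\<^sup>2 \<noteq> 0" using assms(1) by (simp add: sum_power2_eq_zero_iff)
  define h where "h = p * snd v - q * fst v"
  have "(p\<^sup>2 + q\<^sup>2) * fst v = p * r - q * h" and "(p\<^sup>2 + q\<^sup>2) * snd v = q * r + p * h"
    unfolding assms(2)[symmetric] h_def by (simp_all add: algebra_simps power2_eq_square)
  then have "fst v = (p * r - q * h) / (p\<^sup>2 + q\<^sup>2)" and "snd v = (q * r + p * h) / (p\<^sup>2 + q\<^sup>2)"
    using pos by (simp_all add: eq_divide_eq mult.commute)
  then have "v = (p * r / (p\<^sup>2 + q\<^sup>2), q * r / (p\<^sup>2 + q\<^sup>2)) + (h / (p\<^sup>2 + q\<^sup>2)) *\<^sub>R (- q, p)"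
    by (simp add: prod_eq_iff diff_divide_distrib add_divide_distrib mult.commute)
  then show ?thesis by blast
qed

text \<open>By the intermediate value theorem the sign cannot change without an interior zero, so on
  such an interval the absolute value acts as multiplication by a constant. Zeros at the two ends do
  no harm.\<close>

lemma constant_sign:
  fixes f :: "real \<Rightarrow> real"
  assumes "a < b" and cont: "continuous_on {a..b} f" and nz: "\<And>s. s \<in> {a<..<b} \<Longrightarrow> f s \<noteq> 0"
  obtains e where "\<And>s. s \<in> {a..b} \<Longrightarrow> \<bar>f s\<bar> = e * f s"
proof -
  have pos: "\<forall>s\<in>{a..b}. 0 \<le> f s"
    if cont: "continuous_on {a..b} f" and nz: "\<And>s. s \<in> {a<..<b} \<Longrightarrow> f s \<noteq> 0"
      and m: "0 < f ((a + b) / 2)" for f :: "real \<Rightarrow> real"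
  proof (rule ballI, rule ccontr)
    fix s assume s: "s \<in> {a..b}" "\<not> 0 \<le> f s"
    define m where "m = (a + b) / 2"
    have m': "a < m" "m < b" "0 < f m" using \<open>a < b\<close> m by (auto simp: m_def)
    have "\<exists>x. x \<in> {a<..<b} \<and> f x = 0"
    proof (cases "s \<le> m")
      case True
      have "\<exists>x\<ge>s. x \<le> m \<and> f x = 0"
        by (rule IVT') (use s m' True in \<open>auto intro: continuous_on_subset[OF cont]\<close>)
      then obtain x where "s \<le> x" "x \<le> m" "f x = 0" by blast
      moreover have "x \<noteq> s" using \<open>f x = 0\<close> s by auto
      ultimately show ?thesis using s m' by (intro exI[of _ x]) auto
    next
      case False
      have "\<exists>x\<ge>m. x \<le> s \<and> f x = 0"
        by (rule IVT2') (use s m' False in \<open>auto intro: continuous_on_subset[OF cont]\<close>)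
      then obtain x where "m \<le> x" "x \<le> s" "f x = 0" by blast
      moreover have "x \<noteq> s" using \<open>f x = 0\<close> s by auto
      ultimately show ?thesis using s m' by (intro exI[of _ x]) auto
    qed
    then show False using nz by blast
  qed
  have "f ((a + b) / 2) \<noteq> 0" by (rule nz) (use \<open>a < b\<close> in auto)
  then consider "0 < f ((a + b) / 2)" | "0 < - f ((a + b) / 2)" by linarith
  then show thesis
  proof cases
    case 1
    have "\<forall>s\<in>{a..b}. 0 \<le> f s" by (rule pos[OF cont nz 1])
    then show ?thesis by (intro that[of 1]) auto
  next
    case 2
    have "\<forall>s\<in>{a..b}. 0 \<le> - f s"
      by (rule pos[of "\<lambda>s. - f s"]) (use 2 nz in \<open>auto intro: continuous_intros cont\<close>)
    then show ?thesis by (intro that[of "-1"]) auto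
  qed
qed

lemma norm_lift_le: "norm (lift p z) \<le> \<bar>fst p\<bar> + \<bar>snd p\<bar> + \<bar>z\<bar>"
  using norm_le_l1_cart[of "lift p z"] by (simp add: sum_3)

text \<open>The linear map with rows \<open>a1\<close>, \<open>a2\<close>, \<open>e3\<close> moves the direction orthogonal to \<open>a1\<close> and \<open>a2\<close>,
  which the curve avoids, onto the vertical axis. Adding \<open>k (\<bar>x1\<bar> + \<bar>x2\<bar>)\<close> to the height then
  pushes the curve into the upper half space; this map is linear on each of four sectors, so the
  central projection of an arc to a horizontal plane becomes a polygonal path \<open>u\<close>.
  Dividing the horizontal coordinates by the height turns central into parallel projection.\<close>
lemma spherical_curve_diagram:
  fixes \<gamma> :: "real \<Rightarrow> R3" and t :: "nat \<Rightarrow> real" and N :: "nat \<Rightarrow> R3"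
  defines "c \<equiv> radial \<circ> \<gamma>"
  defines "D \<equiv> {y. card {s\<in>{0..<1}. c s = y} = 2}"
  assumes cont: "continuous_on {0..1} \<gamma>" and loop: "\<gamma> 0 = \<gamma> 1" and inj: "inj_on \<gamma> {0..<1}"
    and nz: "0 \<notin> \<gamma> ` {0..1}"
    and t: "t 0 = 0" "t n = 1" "\<And>i. i < n \<Longrightarrow> t i < t (Suc i)"
    and N: "\<And>i. i < n \<Longrightarrow> N i \<noteq> 0"
    and plane: "\<And>i s. i < n \<Longrightarrow> s \<in> {t i..t (Suc i)} \<Longrightarrow> N i \<bullet> \<gamma> s = 0"
    and injc: "\<And>i. i < n \<Longrightarrow> inj_on c {t i..t (Suc i)}"
    and fib: "\<And>y. finite {s\<in>{0..<1}. c s = y}" "\<And>y. card {s\<in>{0..<1}. c s = y} \<le> 2"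
    and fin: "finite D"
    and single: "\<And>i. i \<le> n \<Longrightarrow> card {s\<in>{0..<1}. c s = c (t i)} = 1"
  shows "has_diagram (\<gamma> ` {0..1}) (card D)"
proof -
  have n0: "0 < n" using t(1,2) by (cases n) auto
  have tlt: "t i < t j" if "i < j" "j \<le> n" for i j
    using partition_strict_mono[of n t i j] t(3) that by blast
  have t01: "0 \<le> t i" "t i \<le> 1" if "i \<le> n" for i
    using tlt[of 0 i] tlt[of i n] that t(1,2) by (cases "i = 0"; cases "i = n"; force)+
  have nz': "\<gamma> s \<noteq> 0" if "s \<in> {0..1}" for s using nz that by force
  have piece: "\<exists>i<n. t i \<le> s \<and> s \<le> t (Suc i)" if "s \<in> {0..1}" for s
    using partition_cover[of t s n] that t n0 by auto
  have D: "norm y = 1" "y \<noteq> 0" if "y \<in> D" for y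
  proof -
    have "card {s\<in>{0..<1}. c s = y} = 2" using that by (simp add: D_def)
    then obtain s s' where "{s\<in>{0..<1}. c s = y} = {s, s'}" by (auto simp: card_2_iff)
    then have "s \<in> {s\<in>{0..<1}. c s = y}" by simp
    then have "s \<in> {0..1}" "c s = y" by auto
    then show "norm y = 1" using nz'[of s] by (auto simp: c_def norm_radial)
    then show "y \<noteq> 0" by auto
  qed

  \<comment> \<open>A sample vector in the plane of each arc: if \<open>a1\<close> is not orthogonal
    to it, \<open>a1\<close> is not a multiple of \<open>N i\<close>, and the fold plane of
    \<open>a1\<close> differs from the plane of the arc.\<close>
  define m where "m i = (SOME v. v \<noteq> 0 \<and> N i \<bullet> v = 0)" for i
  have m: "m i \<noteq> 0" "N i \<bullet> m i = 0" for i
  proof -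
    obtain v where "v \<noteq> 0" "orthogonal (N i) v"
      using orthogonal_to_vector_exists[of "N i"] by auto
    then have "\<exists>v. v \<noteq> 0 \<and> N i \<bullet> v = 0" by (auto simp: orthogonal_def)
    from someI_ex[OF this, folded m_def] show "m i \<noteq> 0" "N i \<bullet> m i = 0" by auto
  qed
  \<comment> \<open>Avoiding \<open>D\<close> keeps the fold away from crossings. The radius 1/4,
    taken for both rows, gives \<open>norm (A x - x)\<close> at most half of
    \<open>norm x\<close>.\<close>
  obtain a1 where a1: "norm (a1 - axis 1 1) < 1/4" "\<And>f. f \<in> D \<union> m ` {..<n} \<Longrightarrow> a1 \<bullet> f \<noteq> 0"
    by (rule generic_vector[of "D \<union> m ` {..<n}" "1/4" "axis 1 1"]) (use fin D m in auto)
  have cross1: "cross3 (N i) a1 \<noteq> 0" if i: "i < n" for i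
  proof
    assume "cross3 (N i) a1 = 0"
    then obtain r where "a1 = r *\<^sub>R N i" using N[OF i] by (auto simp: cross_eq_0 collinear_lemma)
    then have "a1 \<bullet> m i = 0" using m by simp
    then show False using a1(2)[of "m i"] i by auto
  qed
  \<comment> \<open>\<open>cross3 (N i) a1\<close> spans the line in which the plane of arc
    \<open>i\<close> meets the first fold plane. Not being orthogonal to it, \<open>a2\<close>
    leaves no nonzero vector of the arc's plane orthogonal to both rows, and is no multiple of
    \<open>N i\<close> either.\<close>
  obtain a2 where a2: "norm (a2 - axis 2 1) < 1/4"
    "\<And>f. f \<in> D \<union> (\<lambda>i. cross3 (N i) a1) ` {..<n} \<Longrightarrow> a2 \<bullet> f \<noteq> 0"
    by (rule generic_vector[of "D \<union> (\<lambda>i. cross3 (N i) a1) ` {..<n}" "1/4" "axis 2 1"])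
       (use fin D cross1 in \<open>auto simp: eq_commute[of 0]\<close>)
  have cross2: "cross3 (N i) a2 \<noteq> 0" if i: "i < n" for i
  proof
    assume "cross3 (N i) a2 = 0"
    then obtain r where "a2 = r *\<^sub>R N i" using N[OF i] by (auto simp: cross_eq_0 collinear_lemma)
    then have "a2 \<bullet> cross3 (N i) a1 = 0" by (simp add: dot_cross_self)
    then show False using a2(2)[of "cross3 (N i) a1"] i by auto
  qed

  define A where "A x = lift (a1 \<bullet> x, a2 \<bullet> x) (x $ 3)" for x
  have linA: "linear A"
    unfolding A_def by (rule linearI) (auto simp: vec_eq_iff forall_3 inner_add_right)
  have nearA: "norm (A x - x) < norm x" if "x \<noteq> 0" for x
  proof -
    have "A x - x = lift ((a1 - axis 1 1) \<bullet> x, (a2 - axis 2 1) \<bullet> x) 0"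
      by (auto simp: A_def vec_eq_iff forall_3 inner_diff_left inner_axis')
    then have "norm (A x - x) \<le> \<bar>(a1 - axis 1 1) \<bullet> x\<bar> + \<bar>(a2 - axis 2 1) \<bullet> x\<bar>"
      using norm_lift_le[of "((a1 - axis 1 1) \<bullet> x, (a2 - axis 2 1) \<bullet> x)" 0] by simp
    also have "\<dots> \<le> norm (a1 - axis 1 1) * norm x + norm (a2 - axis 2 1) * norm x"
      by (intro add_mono Cauchy_Schwarz_ineq2)
    also have "\<dots> \<le> 1/4 * norm x + 1/4 * norm x"
      using a1(1) a2(1) by (intro add_mono mult_right_mono) auto
    also have "\<dots> < norm x" using that by simp
    finally show ?thesis .
  qed
  have A0: "x = 0" if "A x = 0" for x
    using nearA[of x] that by (cases "x = 0") auto
  then have "inj A" using linA by (simp add: linear_injective_0)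
  then obtain Ai where Ai: "linear Ai" "\<And>x. Ai (A x) = x" "\<And>x. A (Ai x) = x"
    using linear_injective_isomorphism[OF linA] by blast

  define w where "w s = \<bar>a1 \<bullet> \<gamma> s\<bar> + \<bar>a2 \<bullet> \<gamma> s\<bar>" for s
  have wpos: "0 < w s" if s: "s \<in> {0..1}" for s
  proof (rule ccontr)
    assume "\<not> 0 < w s"
    then have 0: "a1 \<bullet> \<gamma> s = 0" "a2 \<bullet> \<gamma> s = 0" by (auto simp: w_def)
    obtain i where i: "i < n" "t i \<le> s" "s \<le> t (Suc i)" using piece[OF s] by auto
    then have "N i \<bullet> \<gamma> s = 0" using plane by simp
    then obtain r where r: "\<gamma> s = r *\<^sub>R cross3 (N i) a1"
      using orthogonal_to_two[OF cross1[OF i(1)]] 0 by blast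
    moreover have "a2 \<bullet> cross3 (N i) a1 \<noteq> 0" using a2(2) i(1) by auto
    ultimately have "\<gamma> s = 0" using 0 by auto
    then show False using nz' s by blast
  qed
  have cw: "continuous_on {0..1} w" unfolding w_def by (intro continuous_intros cont)
  obtain s0 where s0: "s0 \<in> {0..1}" "\<And>s. s \<in> {0..1} \<Longrightarrow> w s0 \<le> w s"
    using continuous_attains_inf[OF _ _ cw] by auto
  have "continuous_on {0..1} (\<lambda>s. \<bar>\<gamma> s $ 3\<bar>)" by (intro continuous_intros cont)
  then obtain s1 where s1: "\<And>s. s \<in> {0..1} \<Longrightarrow> \<bar>\<gamma> s $ 3\<bar> \<le> \<bar>\<gamma> s1 $ 3\<bar>"
    using continuous_attains_sup[of "{0..1}" "\<lambda>s. \<bar>\<gamma> s $ 3\<bar>"] by fastforce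
  \<comment> \<open>Steep enough that even at the minimum of \<open>w\<close>, which is positive by
    compactness, the lift exceeds the greatest depth by 1.\<close>
  define k where "k = (\<bar>\<gamma> s1 $ 3\<bar> + 1) / w s0"
  have w0: "0 < w s0" using wpos s0 by blast
  then have k: "0 \<le> k" by (simp add: k_def)
  define g where "g s = \<gamma> s $ 3 + k * w s" for s
  have g1: "1 \<le> g s" if "s \<in> {0..1}" for s
  proof -
    have "\<bar>\<gamma> s1 $ 3\<bar> + 1 = k * w s0" using w0 by (simp add: k_def)
    also have "\<dots> \<le> k * w s" using k s0 that by (intro mult_left_mono) auto
    finally show ?thesis using s1[OF that] by (simp add: g_def)
  qed
  have cg: "continuous_on {0..1} g" unfolding g_def by (intro continuous_intros cont cw)
  define u where "u s = (1 / g s) *\<^sub>R (a1 \<bullet> \<gamma> s, a2 \<bullet> \<gamma> s)" for s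
  have cu: "continuous_on {0..1} u"
    unfolding u_def by (intro continuous_intros cont cg) (use g1 in force)
  \<comment> \<open>The bent map commutes with positive scaling and is injective, so it neither
    merges nor splits rays. Two points with equal \<open>u\<close> lie on one ray, and the ratio of
    their new heights is the factor between them.\<close>
  have uc: "u s = u s' \<longleftrightarrow> c s = c s'" if s: "s \<in> {0..1}" "s' \<in> {0..1}" for s s'
  proof
    assume "c s = c s'"
    then obtain r where r: "0 < r" "\<gamma> s' = r *\<^sub>R \<gamma> s"
      using radial_eq_iff[of "\<gamma> s" "\<gamma> s'"] nz' s by (auto simp: c_def)
    then have "w s' = r * w s" by (simp add: w_def abs_mult algebra_simps)
    then have "g s' = r * g s" using r by (simp add: g_def algebra_simps)
    then show "u s = u s'" using r by (simp add: u_def)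
  next
    assume "u s = u s'"
    define r where "r = g s' / g s"
    have gp: "0 < g s" "0 < g s'" using g1[OF s(1)] g1[OF s(2)] by auto
    then have r: "0 < r" by (simp add: r_def)
    have a: "a1 \<bullet> \<gamma> s' = r * (a1 \<bullet> \<gamma> s)" "a2 \<bullet> \<gamma> s' = r * (a2 \<bullet> \<gamma> s)"
      using \<open>u s = u s'\<close> gp by (auto simp: u_def r_def field_simps)
    then have "w s' = r * w s" using r by (simp add: w_def abs_mult algebra_simps)
    moreover have "g s' = r * g s" using gp by (simp add: r_def)
    ultimately have "\<gamma> s' $ 3 = r * \<gamma> s $ 3" by (simp add: g_def algebra_simps)
    then have "A (\<gamma> s' - r *\<^sub>R \<gamma> s) = 0"
      using a by (simp add: A_def inner_diff_right vec_eq_iff forall_3)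
    then have "\<gamma> s' = r *\<^sub>R \<gamma> s" using A0 by fastforce
    then show "c s = c s'" using radial_eq_iff[of "\<gamma> s" "\<gamma> s'"] nz' s r by (auto simp: c_def)
  qed
  have uc': "u s = u s' \<longleftrightarrow> c s = c s'" if "s \<in> {0..<1}" "s' \<in> {0..<1}" for s s'
    using uc that by simp
  note fin' = fin[unfolded D_def]
  have dbl: "finite {s\<in>{0..<1}. u s = x}" "card {s\<in>{0..<1}. u s = x} \<le> 2"
    "finite {x. card {s\<in>{0..<1}. u s = x} = 2}"
    "card {x. card {s\<in>{0..<1}. u s = x} = 2} = card D" for x
    unfolding D_def by (rule double_values_cong[of "{0..<1}" u c]; fact uc' fib fin')+

  \<comment> \<open>Besides the ends of arcs, the planar path turns where the curve meets a fold
    plane. There are finitely many such parameters, because a fold plane and the plane of an arc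
    share only two points of the sphere.\<close>
  define B where "B = t ` {..n} \<union> ({s \<in> {0..1}. a1 \<bullet> \<gamma> s = 0} \<union> {s \<in> {0..1}. a2 \<bullet> \<gamma> s = 0})"
  have fin_zeros: "finite {s \<in> {0..1}. a \<bullet> \<gamma> s = 0}"
    if cross: "\<And>i. i < n \<Longrightarrow> cross3 (N i) a \<noteq> 0" for a
  proof (rule finite_subset)
    show "{s \<in> {0..1}. a \<bullet> \<gamma> s = 0} \<subseteq> (\<Union>i<n. {s \<in> {t i..t (Suc i)}. a \<bullet> \<gamma> s = 0})"
      using piece by force
    have "finite {s \<in> {t i..t (Suc i)}. a \<bullet> \<gamma> s = 0}" if i: "i < n" for i
    proof (rule inj_on_finite[OF _ _ two_great_circles(1)[OF cross[OF i]]])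
      show "inj_on c {s \<in> {t i..t (Suc i)}. a \<bullet> \<gamma> s = 0}"
        by (rule inj_on_subset[OF injc[OF i]]) auto
      show "c ` {s \<in> {t i..t (Suc i)}. a \<bullet> \<gamma> s = 0} \<subseteq> {y. norm y = 1 \<and> N i \<bullet> y = 0 \<and> a \<bullet> y = 0}"
      proof
        fix y assume "y \<in> c ` {s \<in> {t i..t (Suc i)}. a \<bullet> \<gamma> s = 0}"
        then obtain s where s: "s \<in> {t i..t (Suc i)}" "a \<bullet> \<gamma> s = 0" "y = c s" by auto
        then have "\<gamma> s \<noteq> 0" using nz'[of s] t01[of i] t01[of "Suc i"] i by auto
        then show "y \<in> {y. norm y = 1 \<and> N i \<bullet> y = 0 \<and> a \<bullet> y = 0}"
          using s plane[OF i s(1)] by (simp add: c_def norm_radial inner_radial_eq_0_iff)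
      qed
    qed
    then show "finite (\<Union>i<n. {s \<in> {t i..t (Suc i)}. a \<bullet> \<gamma> s = 0})" by blast
  qed
  have finB: "finite B" unfolding B_def using fin_zeros cross1 cross2 by blast
  have B01: "B \<subseteq> {0..1}" "0 \<in> B" "1 \<in> B"
  proof -
    show "B \<subseteq> {0..1}" unfolding B_def using t01 by auto
    have "t 0 \<in> B" "t n \<in> B" unfolding B_def by auto
    then show "0 \<in> B" "1 \<in> B" using t by auto
  qed
  define X where "X = {s\<in>{0..<1}. \<exists>s'\<in>{0..<1}. s' \<noteq> s \<and> u s' = u s}"
  have XD: "c s \<in> D" if "s \<in> X" for s
  proof -
    obtain s' where s: "s \<in> {0..<1}" "s' \<in> {0..<1}" "s' \<noteq> s" "u s' = u s"
      using \<open>s \<in> X\<close> unfolding X_def by blast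
    then have "{s, s'} \<subseteq> {r\<in>{0..<1}. c r = c s}" using uc' by auto
    then have "card {s, s'} \<le> card {r\<in>{0..<1}. c r = c s}" by (intro card_mono fib)
    then have "card {r\<in>{0..<1}. c r = c s} = 2" using fib(2)[of "c s"] s(3) by simp
    then show ?thesis by (simp add: D_def)
  qed
  have finX: "finite X"
  proof (rule finite_subset)
    show "X \<subseteq> (\<Union>y\<in>D. {s\<in>{0..<1}. c s = y})" using XD unfolding X_def by blast
    show "finite (\<Union>y\<in>D. {s\<in>{0..<1}. c s = y})" using fin fib(1) by blast
  qed
  have BX: "B \<inter> X = {}"
  proof -
    have "t i \<notin> X" if "i \<le> n" for i
      using XD[of "t i"] single[OF that] by (auto simp: D_def)
    moreover have "a \<bullet> \<gamma> s \<noteq> 0" if "s \<in> X" "\<And>y. y \<in> D \<Longrightarrow> a \<bullet> y \<noteq> 0" for a s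
    proof -
      have "\<gamma> s \<noteq> 0" using nz' \<open>s \<in> X\<close> by (auto simp: X_def)
      then show ?thesis using that(2)[OF XD[OF \<open>s \<in> X\<close>]] by (simp add: c_def inner_radial_eq_0_iff)
    qed
    ultimately show ?thesis unfolding B_def using a1(2) a2(2) by blast
  qed
  have seg: "inj_on u {a..b} \<and> (\<exists>p d. \<forall>s\<in>{a..b}. \<exists>r. u s = p + r *\<^sub>R d)"
    if ab: "0 \<le> a" "a < b" "b \<le> 1" and empty: "{a<..<b} \<inter> B = {}" for a b
  proof -
    have "(a + b) / 2 \<in> {0..1}" using ab by auto
    then obtain i where i: "i < n" "t i \<le> (a + b) / 2" "(a + b) / 2 \<le> t (Suc i)" using piece by blast
    have "t i \<in> B" "t (Suc i) \<in> B" using i(1) unfolding B_def by auto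
    then have "t i \<notin> {a<..<b}" "t (Suc i) \<notin> {a<..<b}" using empty by blast+
    then have sub: "{a..b} \<subseteq> {t i..t (Suc i)}" using i ab by auto
    have sub1: "{a..b} \<subseteq> {0..1}" using ab by auto
    have "inj_on u {a..b}"
    proof (rule inj_onI)
      fix x y assume "x \<in> {a..b}" "y \<in> {a..b}" "u x = u y"
      then show "x = y" using uc[of x y] sub sub1 by (intro inj_onD[OF injc[OF i(1)]]) auto
    qed
    moreover
    have cab: "continuous_on {a..b} (\<lambda>s. v \<bullet> \<gamma> s)" for v
      by (intro continuous_intros continuous_on_subset[OF cont sub1])
    have nz1: "a1 \<bullet> \<gamma> s \<noteq> 0" and nz2: "a2 \<bullet> \<gamma> s \<noteq> 0" if "s \<in> {a<..<b}" for s
    proof -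
      have "s \<in> {0..1}" "s \<notin> B" using that empty ab by auto
      then show "a1 \<bullet> \<gamma> s \<noteq> 0" and "a2 \<bullet> \<gamma> s \<noteq> 0" unfolding B_def by blast+
    qed
    obtain e1 where e1: "\<And>s. s \<in> {a..b} \<Longrightarrow> \<bar>a1 \<bullet> \<gamma> s\<bar> = e1 * (a1 \<bullet> \<gamma> s)"
      using constant_sign[OF ab(2) cab nz1] by blast
    obtain e2 where e2: "\<And>s. s \<in> {a..b} \<Longrightarrow> \<bar>a2 \<bullet> \<gamma> s\<bar> = e2 * (a2 \<bullet> \<gamma> s)"
      using constant_sign[OF ab(2) cab nz2] by blast
    \<comment> \<open>Coefficients of the equation of the arc's plane after applying
      \<open>A\<close>.\<close>
    define \<alpha> \<beta> \<kappa> where "\<alpha> = N i \<bullet> Ai (axis 1 1)" and "\<beta> = N i \<bullet> Ai (axis 2 1)" and "\<kappa> = N i \<bullet> Ai (axis 3 1)"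
    have lin: "N i \<bullet> Ai v = \<alpha> * v $ 1 + \<beta> * v $ 2 + \<kappa> * v $ 3" for v
    proof -
      have v: "v = v $ 1 *\<^sub>R axis 1 1 + v $ 2 *\<^sub>R axis 2 1 + v $ 3 *\<^sub>R axis 3 1"
        by (simp add: vec_eq_iff forall_3 axis_def)
      have "Ai v = v $ 1 *\<^sub>R Ai (axis 1 1) + v $ 2 *\<^sub>R Ai (axis 2 1) + v $ 3 *\<^sub>R Ai (axis 3 1)"
        by (rule trans[OF arg_cong[OF v, of Ai]]) (simp only: linear_add[OF Ai(1)] linear_scale[OF Ai(1)])
      then show ?thesis by (simp add: \<alpha>_def \<beta>_def \<kappa>_def inner_add_right algebra_simps)
    qed
    \<comment> \<open>On this piece the bend is linear, so the old height is \<open>g\<close> minus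
      \<open>k\<close> times a linear form in the horizontal coordinates. Substituting this into the
      equation of the plane and dividing by \<open>g\<close> leaves the equation of a line in the
      plane.\<close>
    define p q where "p = \<alpha> - \<kappa> * k * e1" and "q = \<beta> - \<kappa> * k * e2"
    have line: "p * fst (u s) + q * snd (u s) = - \<kappa>" if "s \<in> {a..b}" for s
    proof -
      have gs: "0 < g s" using g1[of s] that sub1 by auto
      have "0 = N i \<bullet> Ai (A (\<gamma> s))" using plane[OF i(1)] that sub Ai(2) by auto
      also have "\<dots> = \<alpha> * (a1 \<bullet> \<gamma> s) + \<beta> * (a2 \<bullet> \<gamma> s) + \<kappa> * \<gamma> s $ 3"
        unfolding lin by (simp add: A_def)
      also have "\<gamma> s $ 3 = g s - k * (e1 * (a1 \<bullet> \<gamma> s) + e2 * (a2 \<bullet> \<gamma> s))"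
        using e1[OF that] e2[OF that] by (simp add: g_def w_def)
      finally have "p * (a1 \<bullet> \<gamma> s) + q * (a2 \<bullet> \<gamma> s) = - \<kappa> * g s"
        by (simp add: p_def q_def algebra_simps)
      moreover have "p * fst (u s) + q * snd (u s) = (p * (a1 \<bullet> \<gamma> s) + q * (a2 \<bullet> \<gamma> s)) / g s"
        by (simp add: u_def add_divide_distrib)
      ultimately show ?thesis using gs by simp
    qed
    \<comment> \<open>Otherwise the equation of the line forces \<open>\<kappa> = 0\<close>, and the
      normal of the arc would be orthogonal to every vector.\<close>
    have "p \<noteq> 0 \<or> q \<noteq> 0"
    proof (rule ccontr)
      assume "\<not> (p \<noteq> 0 \<or> q \<noteq> 0)"
      then have pq: "p = 0" "q = 0" by auto
      then have "\<kappa> = 0" using line[of a] ab by simp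
      then have "N i \<bullet> Ai v = 0" for v unfolding lin using pq by (simp add: p_def q_def)
      then have "N i \<bullet> Ai (A (N i)) = 0" .
      then have "N i \<bullet> N i = 0" unfolding Ai(2) .
      then show False using N i(1) by simp
    qed
    from affine_line_param[OF this line]
    have "\<forall>s\<in>{a..b}. \<exists>r. u s = (p * - \<kappa> / (p\<^sup>2 + q\<^sup>2), q * - \<kappa> / (p\<^sup>2 + q\<^sup>2)) + r *\<^sub>R (- q, p)"
      by blast
    ultimately show ?thesis by blast
  qed

  have "has_diagram ((\<lambda>s. lift (u s) (g s)) ` {0..1}) (card {x. card {s\<in>{0..<1}. u s = x} = 2})"
  proof (rule planar_curve_diagram[OF cu cg _ _ _ dbl(1-3) finX[unfolded X_def] finB B01 BX[unfolded X_def]])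
    have "c 0 = c 1" using loop by (simp add: c_def)
    then show "u 0 = u 1" using uc[of 0 1] by simp
    show "g 0 = g 1" using loop by (simp add: g_def w_def)
    show "inj_on (\<lambda>s. lift (u s) (g s)) {0..<1}"
    proof (rule inj_onI)
      fix x y :: real assume xy: "x \<in> {0..<1}" "y \<in> {0..<1}" "lift (u x) (g x) = lift (u y) (g y)"
      then have e: "u x = u y" "g x = g y" by auto
      have gx: "0 < g x" using g1[of x] xy by auto
      have "a1 \<bullet> \<gamma> x = a1 \<bullet> \<gamma> y" "a2 \<bullet> \<gamma> x = a2 \<bullet> \<gamma> y"
        using e gx by (auto simp: u_def)
      moreover from this have "\<gamma> x $ 3 = \<gamma> y $ 3" using e(2) by (simp add: g_def w_def)
      ultimately have "A (\<gamma> x) = A (\<gamma> y)" by (simp add: A_def)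
      then have "Ai (A (\<gamma> x)) = Ai (A (\<gamma> y))" by (rule arg_cong)
      then have "\<gamma> x = \<gamma> y" unfolding Ai(2) .
      then show "x = y" using inj_onD[OF inj] xy by blast
    qed
  qed (rule seg)
  then have diag: "has_diagram ((\<lambda>s. lift (u s) (g s)) ` {0..1}) (card D)"
    unfolding dbl(4) .
  define \<gamma>1 where "\<gamma>1 s = lift (a1 \<bullet> \<gamma> s, a2 \<bullet> \<gamma> s) (g s)" for s
  have iso1: "ambient_isotopic (\<gamma> ` {0..1}) (A ` \<gamma> ` {0..1})"
    by (rule ambient_isotopic_linear[OF linA nearA])
  define d where "d p = k * (\<bar>fst p\<bar> + \<bar>snd p\<bar>)" for p :: "real \<times> real"
  have "continuous_on UNIV d" unfolding d_def by (intro continuous_intros)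
  from ambient_isotopic_vertical_shift[OF this, of "A ` \<gamma> ` {0..1}"]
  have iso2: "ambient_isotopic (A ` \<gamma> ` {0..1}) (\<gamma>1 ` {0..1})"
    by (simp add: image_image A_def \<gamma>1_def d_def g_def w_def)
  \<comment> \<open>\<open>max 1\<close> extends the scaling factor to a positive continuous
    function of all heights; along the curve the maximum is \<open>g\<close> itself.\<close>
  have im: "(\<lambda>x. lift ((1 / max 1 (x $ 3)) *\<^sub>R proj x) (x $ 3)) ` \<gamma>1 ` {0..1}
      = (\<lambda>s. lift (u s) (g s)) ` {0..1}"
    unfolding image_image
  proof (rule image_cong[OF refl])
    fix s :: real assume "s \<in> {0..1}"
    then have "max 1 (g s) = g s" using g1 by simp
    then show "lift ((1 / max 1 (\<gamma>1 s $ 3)) *\<^sub>R proj (\<gamma>1 s)) (\<gamma>1 s $ 3) = lift (u s) (g s)"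
      by (simp add: \<gamma>1_def u_def)
  qed
  have "continuous_on UNIV (\<lambda>z::real. 1 / max 1 z)"
    by (intro continuous_intros) auto
  then have "ambient_isotopic (\<gamma>1 ` {0..1}) ((\<lambda>x. lift ((1 / max 1 (x $ 3)) *\<^sub>R proj x) (x $ 3)) ` \<gamma>1 ` {0..1})"
    by (rule ambient_isotopic_horizontal_scaling) auto
  then have "ambient_isotopic (\<gamma>1 ` {0..1}) ((\<lambda>s. lift (u s) (g s)) ` {0..1})" unfolding im .
  from ambient_isotopic_trans[OF iso1 ambient_isotopic_trans[OF iso2 this]]
  show ?thesis using diag by (rule has_diagram_isotopic)
qed

lemma has_sps_diagram_imp_has_diagram:
  assumes "has_sps_diagram K n"
  shows "2 \<le> n" and "\<exists>m \<le> n * (n - 2). has_diagram K m"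
proof -
  obtain \<gamma> :: "real \<Rightarrow> R3" and t :: "nat \<Rightarrow> real" and A where H: "let L = \<gamma> ` {0..1}; c = radial \<circ> \<gamma> in
       continuous_on {0..1} \<gamma> \<and> \<gamma> 0 = \<gamma> 1 \<and> inj_on \<gamma> {0..<1} \<and>
       0 \<notin> L \<and> ambient_isotopic K L \<and>
       t 0 = 0 \<and> t n = 1 \<and> (\<forall>i<n. t i < t (Suc i)) \<and>
       (\<forall>i<n. great_arc (A i) \<and> inj_on c {t i..t (Suc i)} \<and> c ` {t i..t (Suc i)} = A i) \<and>
       (\<forall>y. finite {s\<in>{0..<1}. c s = y} \<and> card {s\<in>{0..<1}. c s = y} \<le> 2) \<and>
       finite {y. card {s\<in>{0..<1}. c s = y} = 2} \<and>
       (\<forall>i\<le>n. card {s\<in>{0..<1}. c s = c (t i)} = 1) \<and>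
       (\<forall>i<n. \<forall>j<n. \<forall>s\<in>{t i<..<t (Suc i)}. \<forall>s'\<in>{t j<..<t (Suc j)}.
           s \<noteq> s' \<and> c s = c s' \<longrightarrow>
           \<not> (\<exists>N. N \<noteq> 0 \<and> A i \<union> A j \<subseteq> {x. N \<bullet> x = 0}))"
    using assms unfolding has_sps_diagram_def by blast
  define c where "c = radial \<circ> \<gamma>"
  note H' = H[unfolded Let_def, folded c_def]
  from H' have g: "continuous_on {0..1} \<gamma>" "\<gamma> 0 = \<gamma> 1" "inj_on \<gamma> {0..<1}" "0 \<notin> \<gamma> ` {0..1}"
    and iso: "ambient_isotopic K (\<gamma> ` {0..1})"
    and t: "t 0 = 0" "t n = 1" by simp_all
  from H' have tt: "\<And>i. i < n \<Longrightarrow> t i < t (Suc i)"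
    and A: "\<And>i. i < n \<Longrightarrow> great_arc (A i)" "\<And>i. i < n \<Longrightarrow> inj_on c {t i..t (Suc i)}"
      "\<And>i. i < n \<Longrightarrow> c ` {t i..t (Suc i)} = A i"
    by simp_all
  from H' have fib: "\<And>y. finite {s\<in>{0..<1}. c s = y}" "\<And>y. card {s\<in>{0..<1}. c s = y} \<le> 2"
    and fin: "finite {y. card {s\<in>{0..<1}. c s = y} = 2}"
    and single: "\<And>i. i \<le> n \<Longrightarrow> card {s\<in>{0..<1}. c s = c (t i)} = 1"
    by simp_all
  from H' have "\<forall>i<n. \<forall>j<n. \<forall>s\<in>{t i<..<t (Suc i)}. \<forall>s'\<in>{t j<..<t (Suc j)}.
           s \<noteq> s' \<and> c s = c s' \<longrightarrow> \<not> (\<exists>N. N \<noteq> 0 \<and> A i \<union> A j \<subseteq> {x. N \<bullet> x = 0})"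
    by (elim conjE)
  then have trans: "\<not> (\<exists>N. N \<noteq> 0 \<and> A i \<union> A j \<subseteq> {x. N \<bullet> x = 0})"
    if "i < n" "j < n" "s \<in> {t i<..<t (Suc i)}" "s' \<in> {t j<..<t (Suc j)}" "s \<noteq> s'" "c s = c s'" for i j s s'
    using that by blast
  define N where "N i = (SOME N. N \<noteq> 0 \<and> (\<forall>x\<in>A i. N \<bullet> x = 0))" for i
  have N: "N i \<noteq> 0" "\<And>x. x \<in> A i \<Longrightarrow> N i \<bullet> x = 0" if i: "i < n" for i
  proof -
    obtain M where "M \<noteq> 0" "\<And>x. x \<in> A i \<Longrightarrow> M \<bullet> x = 0" using great_arc_plane[OF A(1)[OF i]] by blast
    then have "\<exists>N. N \<noteq> 0 \<and> (\<forall>x\<in>A i. N \<bullet> x = 0)" by blast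
    from someI_ex[OF this, folded N_def] show "N i \<noteq> 0" "\<And>x. x \<in> A i \<Longrightarrow> N i \<bullet> x = 0" by auto
  qed
  have tlt: "t i < t j" if "i < j" "j \<le> n" for i j
    using partition_strict_mono[of n t i j] tt that by blast
  have t01: "0 \<le> t i" "t i \<le> 1" if "i \<le> n" for i
    using tlt[of 0 i] tlt[of i n] that t by (cases "i = 0"; cases "i = n"; force)+
  have nz: "\<gamma> s \<noteq> 0" if "s \<in> {0..1}" for s using g(4) that by force
  have plane: "N i \<bullet> c s = 0" if "i < n" "s \<in> {t i..t (Suc i)}" for i s
    using N(2)[OF that(1)] A(3)[OF that(1)] that(2) by blast
  have cross: "cross3 (N i) (N j) \<noteq> 0"
    if *: "i < n" "j < n" "s \<in> {t i<..<t (Suc i)}" "s' \<in> {t j<..<t (Suc j)}" "s \<noteq> s'" "c s = c s'"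
    for i j s s'
    by (rule transversal_normals[OF N(1)[OF *(1)] N(1)[OF *(2)] N(2)[OF *(1)] N(2)[OF *(2)] trans[OF *]])
  have loop: "c 0 = c 1" and unit: "\<And>s. s \<in> {0..1} \<Longrightarrow> norm (c s) = 1"
    using g(2) nz by (simp_all add: c_def norm_radial)
  have "2 \<le> n" "card {y. card {s\<in>{0..<1}. c s = y} = 2} \<le> n * (n - 2)"
    by (rule spherical_crossings_bound[of t n c N]; fact t tt loop unit plane A(2) fin single cross)+
  moreover have "has_diagram (\<gamma> ` {0..1}) (card {y. card {s\<in>{0..<1}. c s = y} = 2})"
  proof (rule spherical_curve_diagram[of \<gamma> t n N, folded c_def, OF g t tt N(1) _ A(2) fib fin single])
    fix i s assume i: "i < n" "s \<in> {t i..t (Suc i)}"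
    then have "\<gamma> s \<noteq> 0" using nz[of s] t01[of i] t01[of "Suc i"] by auto
    then show "N i \<bullet> \<gamma> s = 0" using plane[OF i] by (simp add: c_def inner_radial_eq_0_iff)
  qed
  ultimately show "2 \<le> n" and "\<exists>m \<le> n * (n - 2). has_diagram K m"
    using has_diagram_isotopic[OF iso] by blast+
qed

subsection \<open>Existence of spherical stick diagrams\<close>

text \<open>On the preimage of the segment between \<open>\<gamma> a\<close> and
  \<open>\<gamma> b\<close>, \<open>\<gamma>\<close> is a homeomorphism onto that segment, so the
  preimage is connected and contains everything between \<open>a\<close> and \<open>b\<close>. The
  base point is excluded because it has two parameters, 0 and 1, so that a set around it could have
  a preimage in two parts.\<close>

lemma convex_preimage_interval:
  fixes \<gamma> :: "real \<Rightarrow> 'a::euclidean_space"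
  assumes cont: "continuous_on {0..1} \<gamma>" and loop: "\<gamma> 0 = \<gamma> 1" and inj: "inj_on \<gamma> {0..<1}"
    and C: "convex C" "C \<subseteq> \<gamma> ` {0..1}" "\<gamma> 0 \<notin> C"
    and ab: "a \<in> {0..1}" "b \<in> {0..1}" "\<gamma> a \<in> C" "\<gamma> b \<in> C" "a \<le> s" "s \<le> b"
  shows "\<gamma> s \<in> C"
proof -
  define T where "T = closed_segment (\<gamma> a) (\<gamma> b)"
  have TC: "T \<subseteq> C" unfolding T_def by (rule closed_segment_subset) (use C ab in auto)
  define S where "S = {0..1} \<inter> \<gamma> -` T"
  have "closed S" unfolding S_def
    by (rule continuous_closed_preimage[OF cont]) (auto simp: T_def)
  moreover have "bounded S" by (rule bounded_subset[of "{0..1}"]) (auto simp: S_def)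
  ultimately have "compact S" by (simp add: compact_eq_bounded_closed)
  moreover have "continuous_on S \<gamma>" by (rule continuous_on_subset[OF cont]) (auto simp: S_def)
  moreover have "\<gamma> ` S = T" using TC C(2) by (auto simp: S_def)
  moreover have "inj_on \<gamma> S"
  proof (rule inj_on_subset[OF inj])
    have "1 \<notin> S" using TC C(3) loop by (auto simp: S_def)
    show "S \<subseteq> {0..<1}"
    proof
      fix x assume "x \<in> S"
      then have "x \<in> {0..1}" "x \<noteq> 1" using \<open>1 \<notin> S\<close> by (auto simp: S_def)
      then show "x \<in> {0..<1}" by auto
    qed
  qed
  ultimately obtain g where "homeomorphism S T \<gamma> g" using homeomorphism_compact by blast
  then have "S = g ` T" "continuous_on T g" by (auto simp: homeomorphism_def)
  then have "connected S" by (simp add: T_def connected_continuous_image)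
  moreover have "a \<in> S" "b \<in> S" using ab by (auto simp: S_def T_def)
  ultimately have "{a..b} \<subseteq> S" by (rule connected_contains_Icc)
  then have "s \<in> S" using ab by auto
  then show ?thesis using TC by (auto simp: S_def)
qed

text \<open>Half-spaces orthogonal to the segment cut out the two sides of \<open>x\<close>. A third
  slot holds the whole segment when \<open>x\<close> is not on it, so that the number of convex
  pieces is uniform.\<close>

lemma segment_minus_point:
  fixes a b x :: "'a::euclidean_space"
  shows "\<exists>C :: nat \<Rightarrow> 'a set. (\<forall>j. convex (C j)) \<and> closed_segment a b - {x} = (\<Union>j<3. C j)"
proof -
  define C where "C j = (if j = 0 then if x \<in> closed_segment a b then {} else closed_segment a b
     else if j = 1 then closed_segment a b \<inter> {y. (b - a) \<bullet> y < (b - a) \<bullet> x}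
     else closed_segment a b \<inter> {y. (b - a) \<bullet> y > (b - a) \<bullet> x})" for j :: nat
  have "convex (C j)" for j
    unfolding C_def by (auto intro: convex_Int convex_halfspace_lt convex_halfspace_gt)
  moreover have uniq: "y = x" if xy: "x \<in> closed_segment a b" "y \<in> closed_segment a b" "(b - a) \<bullet> y = (b - a) \<bullet> x" for y
  proof -
    obtain r q where r: "x = (1 - r) *\<^sub>R a + r *\<^sub>R b" "y = (1 - q) *\<^sub>R a + q *\<^sub>R b"
      using xy(1,2) by (auto simp: closed_segment_def)
    then have d: "y - x = (q - r) *\<^sub>R (b - a)"
      unfolding r by (simp add: algebra_simps)
    have "(b - a) \<bullet> (y - x) = 0" using xy(3) by (simp add: inner_diff_right)
    then have "(q - r) * ((b - a) \<bullet> (b - a)) = 0" unfolding d by simp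
    then have "y - x = 0" unfolding d by auto
    then show ?thesis by simp
  qed
  then have "y \<in> (\<Union>j<3. C j)" if "y \<in> closed_segment a b - {x}" for y
  proof (cases "x \<in> closed_segment a b")
    case True
    then have "(b - a) \<bullet> y \<noteq> (b - a) \<bullet> x" using uniq[OF True, of y] that by blast
    then have "(b - a) \<bullet> y < (b - a) \<bullet> x \<or> (b - a) \<bullet> y > (b - a) \<bullet> x" by linarith
    then have "y \<in> C 1 \<or> y \<in> C 2" using that by (auto simp: C_def)
    then show ?thesis by force
  next
    case False
    then have "y \<in> C 0" using that by (simp add: C_def)
    then show ?thesis by force
  qed
  moreover have "C j \<subseteq> closed_segment a b - {x}" for j
    by (auto simp: C_def)
  ultimately show ?thesis by (intro exI[of _ C] conjI allI equalityI subsetI) blast+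
qed

text \<open>\<open>knot\<close> provides a parametrisation that knows nothing of the edges. By
  \<open>convex_preimage_interval\<close>, each edge without the base point is visited during at
  most three intervals; cutting at the ends of all these intervals leaves pieces that each stay on
  one edge.\<close>

lemma polygon_loop_partition:
  assumes "knot (polygon vs)"
  obtains \<gamma> :: "real \<Rightarrow> R3" and m t where
    "continuous_on {0..1} \<gamma>" "\<gamma> 0 = \<gamma> 1" "inj_on \<gamma> {0..<1}" "\<gamma> ` {0..1} = polygon vs"
    "t 0 = 0" "t m = 1" "\<And>k. k < m \<Longrightarrow> t k < t (Suc k)" "\<And>k. k < m \<Longrightarrow> inj_on \<gamma> {t k..t (Suc k)}"
    "\<And>k. k < m \<Longrightarrow> \<exists>a b. \<gamma> ` {t k..t (Suc k)} \<subseteq> closed_segment a b"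
proof -
  obtain \<gamma> :: "real \<Rightarrow> R3" where \<gamma>: "continuous_on {0..1} \<gamma>" "\<gamma> 0 = \<gamma> 1" "inj_on \<gamma> {0..<1}"
    "\<gamma> ` {0..1} = polygon vs"
    by (rule knot_loop_param[OF assms])
  define E where "E i = closed_segment (vs ! i) (vs ! ((i + 1) mod length vs))" for i
  have "\<forall>i. \<exists>C :: nat \<Rightarrow> R3 set. (\<forall>j. convex (C j)) \<and> E i - {\<gamma> 0} = (\<Union>j<3. C j)"
    unfolding E_def using segment_minus_point by blast
  then obtain C :: "nat \<Rightarrow> nat \<Rightarrow> R3 set"
    where C: "\<And>i j. convex (C i j)" "\<And>i. E i - {\<gamma> 0} = (\<Union>j<3. C i j)" by metis
  define I where "I = {..<length vs} \<times> {..<3::nat}"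
  define J where "J p = {s\<in>{0..1}. \<gamma> s \<in> C (fst p) (snd p)}" for p
  have P: "polygon vs = (\<Union>i<length vs. E i)" unfolding polygon_def E_def ..
  have CE: "C (fst p) (snd p) \<subseteq> E (fst p)" "\<gamma> 0 \<notin> C (fst p) (snd p)" if "p \<in> I" for p
    using C(2)[of "fst p"] that by (auto simp: I_def)
  have interval: "s \<in> J p" if p: "p \<in> I" and ab: "a \<in> J p" "b \<in> J p" "a \<le> s" "s \<le> b" for p a b s
  proof -
    have "\<gamma> s \<in> C (fst p) (snd p)"
    proof (rule convex_preimage_interval[OF \<gamma>(1-3) C(1)])
      show "C (fst p) (snd p) \<subseteq> \<gamma> ` {0..1}"
      proof -
        have "fst p \<in> {..<length vs}" using p by (auto simp: I_def)
        then show ?thesis unfolding \<gamma>(4) P using CE(1)[OF p] by blast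
      qed
      show "\<gamma> 0 \<notin> C (fst p) (snd p)" by (rule CE(2)[OF p])
    qed (use ab in \<open>auto simp: J_def\<close>)
    moreover have "s \<in> {0..1}" using ab by (auto simp: J_def)
    ultimately show ?thesis by (simp add: J_def)
  qed
  have J01: "J p \<subseteq> {0..1}" for p by (auto simp: J_def)
  have bdd: "bdd_below (J p)" "bdd_above (J p)" for p
    using J01 by (meson bdd_below_Icc bdd_below_mono, meson bdd_above_Icc bdd_above_mono)
  define I' where "I' = {p \<in> I. J p \<noteq> {}}"
  \<comment> \<open>With the breakpoint 1/2 no piece contains both 0 and 1, which makes
    \<open>\<gamma>\<close> injective on every closed piece.\<close>
  define V where "V = {0, 1/2, 1} \<union> (\<lambda>p. Inf (J p)) ` I' \<union> (\<lambda>p. Sup (J p)) ` I'"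
  have InfSup: "Inf (J p) \<in> {0..1}" "Sup (J p) \<in> {0..1}" if "p \<in> I'" for p
  proof -
    obtain x where x: "x \<in> J p" using \<open>p \<in> I'\<close> by (auto simp: I'_def)
    have "0 \<le> Inf (J p)" using x J01[of p] by (intro cInf_greatest) auto
    moreover have "Inf (J p) \<le> x" "x \<le> Sup (J p)" by (rule cInf_lower[OF x bdd(1)], rule cSup_upper[OF x bdd(2)])
    moreover have "Sup (J p) \<le> 1" using x J01[of p] by (intro cSup_least) auto
    moreover have "0 \<le> x" "x \<le> 1" using x J01[of p] by auto
    ultimately show "Inf (J p) \<in> {0..1}" "Sup (J p) \<in> {0..1}" by auto
  qed
  have V: "finite V" "V \<subseteq> {0..1}" "0 \<in> V" "1 \<in> V"
  proof -
    have "finite I'" by (simp add: I'_def I_def)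
    then show "finite V" by (simp add: V_def)
    show "V \<subseteq> {0..1}" using InfSup by (auto simp: V_def)
  qed (simp_all add: V_def)
  obtain m t where t: "t 0 = 0" "t m = 1" "\<And>k. k < m \<Longrightarrow> t k < t (Suc k)" "V = t ` {..m}"
    "\<And>k. k < m \<Longrightarrow> {t k<..<t (Suc k)} \<inter> V = {}"
    by (rule partition_enumeration[OF V]) (rule that)
  have tlt: "t i < t j" if "i < j" "j \<le> m" for i j
    using partition_strict_mono[of m t i j] t(3) that by blast
  have t01: "0 \<le> t i" "t i \<le> 1" if "i \<le> m" for i
  proof -
    have "t i \<in> V" unfolding t(4) using that by blast
    then show "0 \<le> t i" "t i \<le> 1" using V(2) by auto
  qed
  have inj: "inj_on \<gamma> {t k..t (Suc k)}" if k: "k < m" for k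
  proof -
    have "1/2 \<notin> {t k<..<t (Suc k)}" using t(5)[OF k] by (auto simp: V_def)
    then have "t (Suc k) \<le> 1/2 \<or> 1/2 \<le> t k" by auto
    moreover have "0 \<le> t k" "t (Suc k) \<le> 1" using t01[of k] t01[of "Suc k"] k by auto
    ultimately consider "{t k..t (Suc k)} \<subseteq> {0..<1}" | "{t k..t (Suc k)} \<subseteq> {0<..1}" by force
    then show ?thesis
    proof cases
      case 1
      then show ?thesis by (rule inj_on_subset[OF \<gamma>(3)])
    next
      case 2
      have "inj_on \<gamma> {0<..1}"
      proof (rule inj_onI)
        fix x y :: real assume xy: "x \<in> {0<..1}" "y \<in> {0<..1}" "\<gamma> x = \<gamma> y"
        define h where "h s = (if s = 1 then 0 else s)" for s :: real
        have "\<gamma> (h s) = \<gamma> s" for s using \<gamma>(2) by (simp add: h_def)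
        then have "\<gamma> (h x) = \<gamma> (h y)" using xy(3) by simp
        then have "h x = h y" using inj_onD[OF \<gamma>(3), of "h x" "h y"] xy by (auto simp: h_def)
        then show "x = y" using xy by (auto simp: h_def split: if_splits)
      qed
      then show ?thesis using 2 by (rule inj_on_subset)
    qed
  qed
  have line: "\<exists>a b. \<gamma> ` {t k..t (Suc k)} \<subseteq> closed_segment a b" if k: "k < m" for k
  proof -
    \<comment> \<open>The midpoint lies in some interval \<open>J p\<close>. The ends of
      \<open>J p\<close> are breakpoints, hence outside the open piece, so \<open>J p\<close>
      contains all of that piece.\<close>
    define r where "r = (t k + t (Suc k)) / 2"
    have r: "t k < r" "r < t (Suc k)" using t(3)[OF k] by (auto simp: r_def)
    then have r01: "0 < r" "r < 1" using t01[of k] t01[of "Suc k"] k by auto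
    have "\<gamma> r \<noteq> \<gamma> 0" using inj_onD[OF \<gamma>(3), of r 0] r01 by auto
    moreover have "\<gamma> r \<in> polygon vs" using \<gamma>(4) r01 by auto
    then obtain i where i: "i < length vs" "\<gamma> r \<in> E i" unfolding P by auto
    ultimately have "\<gamma> r \<in> (\<Union>j<3. C i j)" unfolding C(2)[symmetric] by simp
    then obtain j where j: "j < 3" "\<gamma> r \<in> C i j" by auto
    define p where "p = (i, j)"
    have p: "p \<in> I" "r \<in> J p" using i j r01 by (auto simp: p_def I_def J_def)
    then have "p \<in> I'" by (auto simp: I'_def)
    then have "Inf (J p) \<in> V" "Sup (J p) \<in> V" by (auto simp: V_def)
    then have "Inf (J p) \<notin> {t k<..<t (Suc k)}" "Sup (J p) \<notin> {t k<..<t (Suc k)}"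
      using t(5)[OF k] by blast+
    moreover have "Inf (J p) \<le> r" "r \<le> Sup (J p)"
      by (rule cInf_lower[OF p(2) bdd(1)], rule cSup_upper[OF p(2) bdd(2)])
    ultimately have IS: "Inf (J p) \<le> t k" "t (Suc k) \<le> Sup (J p)" using r by auto
    have "\<gamma> ` {t k<..<t (Suc k)} \<subseteq> E i"
    proof
      fix y assume "y \<in> \<gamma> ` {t k<..<t (Suc k)}"
      then obtain s where s: "t k < s" "s < t (Suc k)" "y = \<gamma> s" by auto
      obtain a where "a \<in> J p" "a < s" using cInf_lessD[of "J p" s] p(2) IS s by force
      moreover obtain b where "b \<in> J p" "s < b" using less_cSupD[of "J p" s] p(2) IS s by force
      ultimately have "s \<in> J p" using interval[OF p(1), of a b s] by simp
      then show "y \<in> E i" using CE(1)[OF p(1)] s(3) by (auto simp: J_def p_def)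
    qed
    \<comment> \<open>The edge is closed, so continuity adds the two ends of the piece.\<close>
    moreover have cl: "closure {t k<..<t (Suc k)} = {t k..t (Suc k)}"
      by (rule closure_greaterThanLessThan[OF t(3)[OF k]])
    moreover have "continuous_on {t k..t (Suc k)} \<gamma>"
      by (rule continuous_on_subset[OF \<gamma>(1)]) (use t01[of k] t01[of "Suc k"] k in auto)
    ultimately have "\<gamma> ` {t k..t (Suc k)} \<subseteq> E i"
      using image_closure_subset[of "{t k<..<t (Suc k)}" \<gamma> "E i"] by (simp add: E_def)
    then show ?thesis unfolding E_def by blast
  qed
  show thesis by (rule that[OF \<gamma> t(1-3) inj line])
qed

section \<open>Radial projection of a segment\<close>

lemma cross3_segment:
  "cross3 ((1 - r) *\<^sub>R a + r *\<^sub>R b) ((1 - q) *\<^sub>R a + q *\<^sub>R b) = (q - r) *\<^sub>R cross3 a b"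
  by (simp add: vec_eq_iff forall_3 cross_components algebra_simps)

text \<open>Two points on one ray have cross product zero, and for points of the segment this
  product is the difference of their parameters times \<open>cross3 a b\<close>.\<close>

lemma radial_inj_on_segment:
  assumes "cross3 a b \<noteq> 0"
  shows "inj_on radial (closed_segment a b)" and "0 \<notin> closed_segment a b"
proof -
  show 0: "0 \<notin> closed_segment a b"
  proof
    assume "0 \<in> closed_segment a b"
    then obtain r where r: "0 = (1 - r) *\<^sub>R a + r *\<^sub>R b" by (auto simp: closed_segment_def)
    have "(q - r) *\<^sub>R cross3 a b = 0" for q
      using cross3_segment[of r a b q] by (simp flip: r)
    from this[of "r + 1"] show False using assms by simp
  qed
  show "inj_on radial (closed_segment a b)"
  proof (rule inj_onI)
    fix x y assume xy: "x \<in> closed_segment a b" "y \<in> closed_segment a b" "radial x = radial y"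
    then have "x \<noteq> 0" "y \<noteq> 0" using 0 by auto
    then obtain k where k: "y = k *\<^sub>R x" using radial_eq_iff xy(3) by blast
    obtain r q where r: "x = (1 - r) *\<^sub>R a + r *\<^sub>R b" "y = (1 - q) *\<^sub>R a + q *\<^sub>R b"
      using xy(1,2) by (auto simp: closed_segment_def)
    have "cross3 x y = 0" unfolding k by (simp add: cross_mult_right)
    then have "(q - r) *\<^sub>R cross3 a b = 0" unfolding r cross3_segment .
    then show "x = y" using assms r by simp
  qed
qed

text \<open>Gram-Schmidt gives an orthonormal pair \<open>u\<close>, \<open>w\<close> with
  \<open>a\<close> along \<open>u\<close> and \<open>b\<close> on the side of positive
  \<open>w\<close>. The whole segment has nonnegative \<open>w\<close>-component, so its angle from
  \<open>u\<close> is an arccosine. This angle \<open>f\<close> is continuous and injective and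
  starts at 0; hence it sweeps an interval of length at most \<open>pi\<close>.\<close>

lemma great_arc_radial_segment:
  assumes n: "cross3 a b \<noteq> 0"
  shows "great_arc (radial ` closed_segment a b)"
proof -
  have ab0: "a \<noteq> 0" using n by auto
  define u where "u = radial a"
  define e where "e = b - (b \<bullet> u) *\<^sub>R u"
  have u: "norm u = 1" "a = norm a *\<^sub>R u" using ab0 by (simp_all add: u_def radial_def)
  have e0: "e \<noteq> 0"
  proof
    assume "e = 0"
    then have b: "b = (b \<bullet> u) *\<^sub>R u" by (simp add: e_def)
    have "cross3 (norm a *\<^sub>R u) ((b \<bullet> u) *\<^sub>R u) = 0" by (simp add: cross_mult_left cross_mult_right)
    then show False using n by (simp flip: u(2) b)
  qed
  define w where "w = radial e"
  have uu: "u \<bullet> u = 1" using u(1) by (simp add: dot_square_norm)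
  have ue: "u \<bullet> e = 0" by (simp add: e_def inner_diff_right uu inner_commute)
  have w: "norm w = 1" "u \<bullet> w = 0" using e0 ue by (simp_all add: w_def norm_radial inner_radial_eq_0_iff)
  have ww: "w \<bullet> w = 1" using w(1) by (simp add: dot_square_norm)
  have b: "b = (b \<bullet> u) *\<^sub>R u + norm e *\<^sub>R w" using e0 by (simp add: w_def radial_def e_def)
  define x where "x r = (1 - r) *\<^sub>R a + r *\<^sub>R b" for r
  have seg: "closed_segment a b = x ` {0..1}" by (auto simp: closed_segment_def x_def)
  define f where "f r = arccos ((x r \<bullet> u) / norm (x r))" for r
  have x0: "x r \<noteq> 0" if "r \<in> {0..1}" for r
    using radial_inj_on_segment(2)[OF n] that unfolding seg by force
  have cs: "\<bar>(x r \<bullet> u) / norm (x r)\<bar> \<le> 1" if "r \<in> {0..1}" for r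
    using Cauchy_Schwarz_ineq2[of "x r" u] x0[OF that] u(1) by (simp add: abs_divide divide_le_eq)
  have rad: "radial (x r) = cos (f r) *\<^sub>R u + sin (f r) *\<^sub>R w" if r: "r \<in> {0..1}" for r
  proof -
    define \<alpha> \<beta> where "\<alpha> = (1 - r) * norm a + r * (b \<bullet> u)" and "\<beta> = r * norm e"
    have xr: "x r = \<alpha> *\<^sub>R u + \<beta> *\<^sub>R w"
      unfolding x_def by (subst u(2), subst b) (simp add: \<alpha>_def \<beta>_def algebra_simps)
    have \<alpha>: "x r \<bullet> u = \<alpha>" using w(2) uu by (simp add: xr inner_add_left inner_commute[of w u])
    have "0 \<le> \<beta>" using r by (simp add: \<beta>_def)
    have nx: "(norm (x r))\<^sup>2 = \<alpha>\<^sup>2 + \<beta>\<^sup>2"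
      unfolding power2_norm_eq_inner xr using w(2) uu ww
      by (simp add: inner_add_left inner_add_right inner_commute power2_eq_square)
    have npos: "0 < norm (x r)" using x0[OF r] by simp
    have c: "cos (f r) = \<alpha> / norm (x r)" using cs[OF r] by (simp add: f_def \<alpha> cos_arccos_abs)
    have "sin (f r) = sqrt (1 - (\<alpha> / norm (x r))\<^sup>2)"
      unfolding f_def \<alpha> by (rule sin_arccos_abs) (use cs[OF r] \<alpha> in simp)
    also have "1 - (\<alpha> / norm (x r))\<^sup>2 = ((norm (x r))\<^sup>2 - \<alpha>\<^sup>2) / (norm (x r))\<^sup>2"
      using npos by (simp add: power_divide diff_divide_distrib)
    also have "\<dots> = (\<beta> / norm (x r))\<^sup>2" using nx by (simp add: power_divide)
    \<comment> \<open>Nonnegativity of \<open>\<beta>\<close> selects the root, so the sine is the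
      \<open>w\<close>-component with its sign.\<close>
    also have "sqrt \<dots> = \<beta> / norm (x r)" using \<open>0 \<le> \<beta>\<close> npos by simp
    finally have s: "sin (f r) = \<beta> / norm (x r)" .
    show ?thesis unfolding c s radial_def by (subst (2) xr) (simp add: scaleR_add_right)
  qed
  have cf: "continuous_on {0..1} f"
    unfolding f_def
  proof (rule continuous_on_arccos)
    show "continuous_on {0..1} (\<lambda>r. (x r \<bullet> u) / norm (x r))"
      unfolding x_def by (intro continuous_intros) (use x0 in \<open>auto simp: x_def\<close>)
    show "\<forall>r\<in>{0..1}. -1 \<le> (x r \<bullet> u) / norm (x r) \<and> (x r \<bullet> u) / norm (x r) \<le> 1"
    proof
      fix r :: real assume "r \<in> {0..1}"
      from cs[OF this] show "-1 \<le> (x r \<bullet> u) / norm (x r) \<and> (x r \<bullet> u) / norm (x r) \<le> 1"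
        by linarith
    qed
  qed
  have injx: "inj_on x {0..1}"
  proof (rule inj_onI)
    fix r q assume "x r = x q"
    then have "cross3 (x r) (x q) = 0" by simp
    then show "r = q" using n unfolding x_def cross3_segment by simp
  qed
  have "inj_on f {0..1}"
  proof (rule inj_onI)
    fix r q :: real assume rq: "r \<in> {0..1}" "q \<in> {0..1}" "f r = f q"
    then have "radial (x r) = radial (x q)" using rad by simp
    then have "x r = x q" using rq inj_onD[OF radial_inj_on_segment(1)[OF n]] unfolding seg by blast
    then show "r = q" using inj_onD[OF injx] rq by blast
  qed
  then have "f ` closed_segment 0 1 = closed_segment (f 0) (f 1)"
    using cf by (intro continuous_injective_image_segment_1) (simp_all add: closed_segment_eq_real_ivl)
  moreover have f0: "f 0 = 0"
    using ab0 uu by (subst f_def) (simp add: x_def u_def radial_def dot_square_norm power2_eq_square)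
  have f1: "0 \<le> f 1" "f 1 \<le> pi"
  proof -
    have "\<bar>(x 1 \<bullet> u) / norm (x 1)\<bar> \<le> 1" by (rule cs) simp
    then have "-1 \<le> (x 1 \<bullet> u) / norm (x 1)" "(x 1 \<bullet> u) / norm (x 1) \<le> 1" by linarith+
    then show "0 \<le> f 1" "f 1 \<le> pi" unfolding f_def by (rule arccos_lbound, rule arccos_ubound)
  qed
  moreover have "f 1 \<noteq> f 0" using inj_onD[OF \<open>inj_on f {0..1}\<close>, of 1 0] by auto
  ultimately have im: "f ` {0..1} = {0..f 1}" "0 < f 1"
    by (simp_all add: closed_segment_eq_real_ivl f0)
  have "radial ` closed_segment a b = (\<lambda>s. cos s *\<^sub>R u + sin s *\<^sub>R w) ` f ` {0..1}"
    unfolding seg image_image by (rule image_cong) (use rad in auto)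
  also have "\<dots> = (\<lambda>s. cos s *\<^sub>R u + sin s *\<^sub>R w) ` {0..f 1}" unfolding im ..
  finally show ?thesis
    unfolding great_arc_def using u(1) w im(2) f1(2) pi_gt_zero
    by (intro exI[of _ u] exI[of _ w] exI[of _ "f 1"]) auto
qed

section \<open>Linear algebra and null sets for the choice of a viewpoint\<close>

lemma in_span_of_two:
  fixes a b x :: R3
  assumes n: "cross3 a b \<noteq> 0" and x: "cross3 a b \<bullet> x = 0"
  obtains \<alpha> \<beta> where "x = \<alpha> *\<^sub>R a + \<beta> *\<^sub>R b"
proof -
  define n where "n = cross3 a b"
  have nn: "n \<bullet> n \<noteq> 0" using n by (simp add: n_def)
  \<comment> \<open>Cramer's rule for the basis \<open>a\<close>, \<open>b\<close>,
    \<open>n\<close>, whose determinant is \<open>n \<bullet> n\<close>.\<close>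
  have "(n \<bullet> n) *\<^sub>R x = (cross3 x b \<bullet> n) *\<^sub>R a + (cross3 a x \<bullet> n) *\<^sub>R b + (n \<bullet> x) *\<^sub>R n"
    unfolding n_def by (simp add: vec_eq_iff forall_3 cross_components inner_vec_def sum_3 algebra_simps)
  then have "(n \<bullet> n) *\<^sub>R x = (cross3 x b \<bullet> n) *\<^sub>R a + (cross3 a x \<bullet> n) *\<^sub>R b"
    using x by (simp add: n_def)
  then have "x = (1 / (n \<bullet> n)) *\<^sub>R ((cross3 x b \<bullet> n) *\<^sub>R a + (cross3 a x \<bullet> n) *\<^sub>R b)"
    using nn by (metis (no_types) divide_inverse_commute divide_self_if scaleR_one scaleR_scaleR mult.right_neutral)
  then show thesis using that by (simp add: scaleR_add_right)
qed

text \<open>A differentiable image of the plane in space has measure zero. The monomials are those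
  that occur when the trisecant condition is expanded in its two parameters.\<close>

lemma negligible_polynomial_surface:
  fixes a b c d e :: R3
  shows "negligible (range (\<lambda>(x, y). a + x *\<^sub>R b + y *\<^sub>R c + (x * y) *\<^sub>R d + (x * x * y) *\<^sub>R e))"
proof (rule negligible_differentiable_image_lowdim)
  show "DIM(real \<times> real) < DIM(R3)" by simp
  have "fst differentiable at p" "snd differentiable at p" for p :: "real \<times> real"
    by (rule bounded_linear_imp_differentiable; rule bounded_linear_fst bounded_linear_snd)+
  then show "(\<lambda>(x, y). a + x *\<^sub>R b + y *\<^sub>R c + (x * y) *\<^sub>R d + (x * x * y) *\<^sub>R e) differentiable_on UNIV"
    unfolding case_prod_unfold differentiable_on_def by (auto intro!: derivative_intros)
qed

lemma finite_card_le_2: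
  assumes "\<And>x y z. x \<in> S \<Longrightarrow> y \<in> S \<Longrightarrow> z \<in> S \<Longrightarrow> x = y \<or> y = z \<or> x = z"
  shows "finite S \<and> card S \<le> 2"
proof -
  have no3: "\<not> (\<exists>T. T \<subseteq> S \<and> card T = 3)"
  proof
    assume "\<exists>T. T \<subseteq> S \<and> card T = 3"
    then obtain T where T: "T \<subseteq> S" "card T = 3" by blast
    obtain x y z where "T = {x, y, z}" "x \<noteq> y" "y \<noteq> z" "x \<noteq> z"
      using T(2) unfolding card_3_iff by auto
    then show False using assms[of x y z] T(1) by blast
  qed
  have "finite S"
  proof (rule ccontr)
    assume "infinite S"
    from infinite_arbitrarily_large[OF this, of 3] show False using no3 by blast
  qed
  moreover have "card S \<le> 2"
  proof (rule ccontr)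
    assume "\<not> card S \<le> 2"
    then have "3 \<le> card S" by simp
    then obtain T where "T \<subseteq> S" "card T = 3" by (rule obtain_subset_with_card_n)
    then show False using no3 by blast
  qed
  ultimately show ?thesis ..
qed

text \<open>The two genericity conditions say that the origin lies in no plane spanned by an edge and
  a vertex, and on no line that meets the lines of three edges in different points; in
  \<open>no_trisecant\<close> the point \<open>v i + x d i\<close> is on the first line and the cross product is the direction
  of the transversal through it.\<close>
lemma has_sps_diagram_generic_viewpoint:
  fixes \<gamma> :: "real \<Rightarrow> R3" and t :: "nat \<Rightarrow> real"
  defines "v \<equiv> \<lambda>k. \<gamma> (t k)"
  defines "d \<equiv> \<lambda>k. \<gamma> (t (Suc k)) - \<gamma> (t k)"
  assumes cont: "continuous_on {0..1} \<gamma>" and loop: "\<gamma> 0 = \<gamma> 1" and inj: "inj_on \<gamma> {0..<1}"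
    and t: "t 0 = 0" "t m = 1" "\<And>k. k < m \<Longrightarrow> t k < t (Suc k)"
    and injp: "\<And>k. k < m \<Longrightarrow> inj_on \<gamma> {t k..t (Suc k)}"
    and edge: "\<And>k. k < m \<Longrightarrow> \<gamma> ` {t k..t (Suc k)} = closed_segment (v k) (v (Suc k))"
    and no_plane: "\<And>k l x y. k < m \<Longrightarrow> l \<le> m \<Longrightarrow> v k + x *\<^sub>R d k + y *\<^sub>R (v l - v k) \<noteq> 0"
    and no_trisecant: "\<And>i j k x y. i < m \<Longrightarrow> j < m \<Longrightarrow> k < m \<Longrightarrow>
      v i + x *\<^sub>R d i + y *\<^sub>R cross3 (cross3 (v j - (v i + x *\<^sub>R d i)) (d j)) (cross3 (v k - (v i + x *\<^sub>R d i)) (d k)) \<noteq> 0"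
    and iso: "ambient_isotopic K (\<gamma> ` {0..1})"
  shows "has_sps_diagram K m"
proof -
  have m0: "0 < m" using t(1,2) by (cases m) auto
  have tlt: "t i < t j" if "i < j" "j \<le> m" for i j
    using partition_strict_mono[of m t i j] t(3) that by blast
  have t0: "0 \<le> t i" if "i \<le> m" for i using tlt[of 0 i] t that by (cases "i = 0") auto
  have t1: "t i \<le> 1" if "i \<le> m" for i using tlt[of i m] t that by (cases "i = m") auto
  have t1': "t i < 1" if "i < m" for i using tlt[of i m] t that by auto
  have piece: "\<exists>k<m. t k \<le> s \<and> s \<le> t (Suc k)" if "s \<in> {0..1}" for s
    using partition_cover[of t s m] that t m0 by auto
  \<comment> \<open>Normal of the plane through the origin and edge \<open>k\<close>, which carries
    the radial image of the edge.\<close>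
  define n where "n k = cross3 (v k) (d k)" for k
  have n_alt: "n k = cross3 (v k) (v (Suc k))" for k
    by (simp add: n_def d_def v_def Cross3.right_diff_distrib)
  have v_ne: "v k \<noteq> v (Suc k)" if k: "k < m" for k
  proof
    assume "v k = v (Suc k)"
    then have "t k = t (Suc k)"
      using inj_onD[OF injp[OF k], of "t k" "t (Suc k)"] t(3)[OF k] by (simp add: v_def)
    then show False using t(3)[OF k] by simp
  qed
  have n0: "n k \<noteq> 0" if k: "k < m" for k
  proof
    assume "n k = 0"
    moreover have "d k \<noteq> 0" using v_ne[OF k] by (simp add: d_def v_def)
    moreover have "collinear {0, d k, v k}" using \<open>n k = 0\<close> by (simp add: n_def cross_eq_0 insert_commute)
    ultimately obtain r where r: "v k = r *\<^sub>R d k" by (auto simp: collinear_lemma)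
    have "v k + (- r) *\<^sub>R d k + 0 *\<^sub>R (v 0 - v k) \<noteq> 0" by (rule no_plane) (use k in auto)
    then show False using r by simp
  qed
  have nv: "n k \<bullet> v k = 0" "n k \<bullet> d k = 0" for k by (simp_all add: n_def dot_cross_self)
  have nline: "n k \<bullet> (v k + r *\<^sub>R d k) = 0" for k r by (simp add: inner_add_right nv)
  \<comment> \<open>If \<open>v l\<close> lay in the plane of the origin and edge \<open>k\<close>
    but off the line of the edge, then edge and vertex would span that plane, contrary to
    \<open>no_plane\<close>. The \<open>y\<close> below is the coefficient that reaches the
    origin.\<close>
  have on_line: "\<exists>r. v l = v k + r *\<^sub>R d k" if kl: "k < m" "l \<le> m" and 0: "n k \<bullet> v l = 0" for k l
  proof -
    obtain \<alpha> \<beta> where ab: "v l = \<alpha> *\<^sub>R v k + \<beta> *\<^sub>R d k"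
      using in_span_of_two[of "v k" "d k" "v l"] n0[OF kl(1)] 0 unfolding n_def by blast
    have "\<alpha> = 1"
    proof (rule ccontr)
      assume \<alpha>: "\<alpha> \<noteq> 1"
      define y where "y = 1 / (1 - \<alpha>)"
      have "v k + (- y * \<beta>) *\<^sub>R d k + y *\<^sub>R (v l - v k) = (1 - y * (1 - \<alpha>)) *\<^sub>R v k"
        unfolding ab by (simp add: algebra_simps)
      also have "\<dots> = 0" using \<alpha> by (simp add: y_def)
      finally show False using no_plane[OF kl] by blast
    qed
    then show ?thesis using ab by auto
  qed
  \<comment> \<open>The line of an edge misses the origin, so it meets each line through the origin
    at most once.\<close>
  have same_line: "x = y"
    if k: "k < m" and x: "x = v k + a *\<^sub>R d k" and y: "y = v k + b *\<^sub>R d k" and r: "y = r *\<^sub>R x" for k x y a b r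
  proof -
    have "cross3 x y = 0" by (simp add: r cross_mult_right)
    moreover have "cross3 x y = (b - a) *\<^sub>R n k"
      unfolding x y n_def by (simp add: vec_eq_iff forall_3 cross_components algebra_simps)
    ultimately show ?thesis using n0[OF k] x y by simp
  qed
  have point: "\<exists>r. \<gamma> s = v k + r *\<^sub>R d k" if k: "k < m" and s: "s \<in> {t k..t (Suc k)}" for k s
  proof -
    have "\<gamma> s \<in> closed_segment (v k) (v (Suc k))" using edge[OF k] s by blast
    then obtain r where "\<gamma> s = (1 - r) *\<^sub>R v k + r *\<^sub>R v (Suc k)" by (auto simp: closed_segment_def)
    then have "\<gamma> s = v k + r *\<^sub>R d k" by (simp add: d_def v_def algebra_simps)
    then show ?thesis ..
  qed
  have n\<gamma>: "n k \<bullet> \<gamma> s = 0" if "k < m" "s \<in> {t k..t (Suc k)}" for k s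
    using point[OF that] nline by force
  have nz: "\<gamma> s \<noteq> 0" if s: "s \<in> {0..1}" for s
  proof -
    obtain k where k: "k < m" "s \<in> {t k..t (Suc k)}" using piece[OF s] by auto
    then obtain r where "\<gamma> s = v k + r *\<^sub>R d k" using point by blast
    then show ?thesis using no_plane[of k 0 r 0] k(1) by simp
  qed
  define c where "c = radial \<circ> \<gamma>"
  have c_eq: "c s = c s' \<longleftrightarrow> (\<exists>r>0. \<gamma> s' = r *\<^sub>R \<gamma> s)" if "s \<in> {0..1}" "s' \<in> {0..1}" for s s'
    using radial_eq_iff[of "\<gamma> s" "\<gamma> s'"] nz that by (simp add: c_def)
  have A: "great_arc (radial ` closed_segment (v k) (v (Suc k)))"
    and injc: "inj_on c {t k..t (Suc k)}"
    and cim: "c ` {t k..t (Suc k)} = radial ` closed_segment (v k) (v (Suc k))" if k: "k < m" for k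
  proof -
    have ne: "cross3 (v k) (v (Suc k)) \<noteq> 0" using n0[OF k] by (simp add: n_alt)
    show "great_arc (radial ` closed_segment (v k) (v (Suc k)))"
      by (rule great_arc_radial_segment[OF ne])
    show "c ` {t k..t (Suc k)} = radial ` closed_segment (v k) (v (Suc k))"
      unfolding c_def image_comp[symmetric] edge[OF k] ..
    show "inj_on c {t k..t (Suc k)}"
      unfolding c_def
      by (rule comp_inj_on[OF injp[OF k]]) (simp add: edge[OF k] radial_inj_on_segment(1)[OF ne])
  qed
  \<comment> \<open>Here a vertex is shown to be the only point of the curve on its ray: any other
    would lie on an edge whose line contains the vertex by \<open>on_line\<close>, and
    \<open>same_line\<close> identifies the two.\<close>
  have vertex: "\<gamma> s = \<gamma> (t l)" if s: "s \<in> {0..1}" and l: "l \<le> m" and eq: "c s = c (t l)" for s l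
  proof -
    have tl: "t l \<in> {0..1}" using t0[OF l] t1[OF l] by simp
    obtain k where k: "k < m" "s \<in> {t k..t (Suc k)}" using piece[OF s] by auto
    obtain r where r: "\<gamma> (t l) = r *\<^sub>R \<gamma> s" using eq c_eq[OF s tl] by blast
    then have "n k \<bullet> v l = 0" using n\<gamma>[OF k] by (simp add: v_def)
    then obtain b where b: "v l = v k + b *\<^sub>R d k" using on_line[OF k(1) l] by blast
    obtain a where a: "\<gamma> s = v k + a *\<^sub>R d k" using point[OF k] by blast
    have "v l = r *\<^sub>R \<gamma> s" using r by (simp add: v_def)
    from same_line[OF k(1) a b this] show ?thesis by (simp add: v_def)
  qed
  have single: "card {s\<in>{0..<1}. c s = c (t l)} = 1" if l: "l \<le> m" for l
  proof -
    define h where "h = (if l = m then 0 else t l)"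
    have h: "h \<in> {0..<1}" "\<gamma> h = \<gamma> (t l)"
      using t0[OF l] t1'[of l] l t(2) loop by (auto simp: h_def)
    have "{s\<in>{0..<1}. c s = c (t l)} = {h}"
    proof (intro equalityI subsetI)
      fix s assume s: "s \<in> {s\<in>{0..<1}. c s = c (t l)}"
      then have "\<gamma> s = \<gamma> h" using vertex[OF _ l, of s] h(2) by simp
      then show "s \<in> {h}" using inj_onD[OF inj, of s h] h(1) s by simp
    qed (use h in \<open>simp add: c_def\<close>)
    then show ?thesis by simp
  qed
  have interior: "\<exists>k<m. s \<in> {t k<..<t (Suc k)}"
    if s: "s \<in> {0..<1}" "s' \<in> {0..<1}" "s \<noteq> s'" "c s = c s'" for s s'
  proof -
    have ne: "s \<noteq> t l" if l: "l \<le> m" for l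
    proof
      assume "s = t l"
      then have "{s, s'} \<subseteq> {r\<in>{0..<1}. c r = c (t l)}" using s by auto
      moreover obtain a where "{r\<in>{0..<1}. c r = c (t l)} = {a}"
        by (rule card_1_singletonE[OF single[OF l]])
      ultimately have "{s, s'} \<subseteq> {a}" by (simp only:)
      then show False using s(3) by auto
    qed
    have "s \<in> {0..1}" using s(1) by auto
    then obtain k where "k < m" "t k \<le> s" "s \<le> t (Suc k)" using piece by blast
    then show ?thesis using ne[of k] ne[of "Suc k"] by (intro exI[of _ k]) auto
  qed
  \<comment> \<open>With parallel normals both edges lie on one line by \<open>on_line\<close>, and
    two points of it on the same ray coincide, against injectivity of
    \<open>\<gamma>\<close>.\<close>
  have cross: "cross3 (n k) (n l) \<noteq> 0"
    if k: "k < m" "s \<in> {t k<..<t (Suc k)}" and l: "l < m" "s' \<in> {t l<..<t (Suc l)}"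
      and ne: "s \<noteq> s'" and eq: "c s = c s'" for k l s s'
  proof
    assume "cross3 (n k) (n l) = 0"
    then have "collinear {0, n l, n k}" by (simp add: cross_eq_0 insert_commute)
    then obtain r where r: "n k = r *\<^sub>R n l" using n0[OF l(1)] by (auto simp: collinear_lemma)
    have s: "s \<in> {t k..t (Suc k)}" "s' \<in> {t l..t (Suc l)}" using k l by auto
    have s01: "s \<in> {0<..<1}" "s' \<in> {0<..<1}"
      using k l t0[of k] t0[of l] t1[of "Suc k"] t1[of "Suc l"] by auto
    have "n k \<bullet> v l = 0" "n k \<bullet> v (Suc l) = 0"
      unfolding r using nv(1)[of l] by (simp_all add: n_alt dot_cross_self)
    then obtain b b' where b: "v l = v k + b *\<^sub>R d k" "v (Suc l) = v k + b' *\<^sub>R d k"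
      using on_line[OF k(1), of l] on_line[OF k(1), of "Suc l"] l(1) by auto
    obtain q where q: "\<gamma> s' = v l + q *\<^sub>R d l" using point[OF l(1) s(2)] by blast
    have "d l = v (Suc l) - v l" by (simp add: d_def v_def)
    also have "\<dots> = (b' - b) *\<^sub>R d k" unfolding b by (simp add: algebra_simps)
    finally have dl: "d l = (b' - b) *\<^sub>R d k" .
    then have q': "\<gamma> s' = v k + (b + q * (b' - b)) *\<^sub>R d k"
      unfolding q b(1) dl by (simp add: algebra_simps)
    obtain a where a: "\<gamma> s = v k + a *\<^sub>R d k" using point[OF k(1) s(1)] by blast
    obtain x where x: "\<gamma> s' = x *\<^sub>R \<gamma> s" using eq c_eq[of s s'] s01 by auto
    have "\<gamma> s = \<gamma> s'" by (rule same_line[OF k(1) a q' x])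
    then show False using inj_onD[OF inj, of s s'] s01 ne by auto
  qed
  \<comment> \<open>Three points on one ray would make this ray a line through the origin that meets
    three edges at different points, which \<open>no_trisecant\<close> excludes.\<close>
  have fib: "finite {s\<in>{0..<1}. c s = y} \<and> card {s\<in>{0..<1}. c s = y} \<le> 2" for y
  proof (rule finite_card_le_2, rule ccontr)
    fix s1 s2 s3
    assume "s1 \<in> {s\<in>{0..<1}. c s = y}" "s2 \<in> {s\<in>{0..<1}. c s = y}" "s3 \<in> {s\<in>{0..<1}. c s = y}"
      and "\<not> (s1 = s2 \<or> s2 = s3 \<or> s1 = s3)"
    then have s: "s1 \<in> {0..<1}" "s2 \<in> {0..<1}" "s3 \<in> {0..<1}" "s1 \<noteq> s2" "s2 \<noteq> s3" "s1 \<noteq> s3"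
      "c s1 = c s2" "c s2 = c s3" "c s1 = c s3" by auto
    obtain i where i: "i < m" "s1 \<in> {t i<..<t (Suc i)}" using interior[OF s(1,2,4,7)] by blast
    obtain j where j: "j < m" "s2 \<in> {t j<..<t (Suc j)}" using interior[OF s(2,3,5,8)] by blast
    obtain k where k: "k < m" "s3 \<in> {t k<..<t (Suc k)}"
      using interior[OF s(3,2) s(5)[symmetric] s(8)[symmetric]] by blast
    have X: "cross3 (n j) (n k) \<noteq> 0" by (rule cross[OF j k s(5,8)])
    obtain a where a: "\<gamma> s1 = v i + a *\<^sub>R d i" using point[OF i(1), of s1] i(2) by auto
    \<comment> \<open>The plane through \<open>\<gamma> s1\<close> and the line of edge
      \<open>l\<close> contains the origin, because it contains a second point of the ray. Its
      normal is therefore a multiple of \<open>n l\<close>; the factor \<open>(r - 1) / r\<close> is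
      nonzero since the two points differ.\<close>
    have ray: "\<exists>q r. q \<noteq> 0 \<and> cross3 (v l - \<gamma> s1) (d l) = q *\<^sub>R n l \<and> r *\<^sub>R \<gamma> s1 = \<gamma> s'"
      if l: "l < m" "s' \<in> {t l<..<t (Suc l)}" and s': "s' \<in> {0..<1}" "s1 \<noteq> s'" "c s1 = c s'" for l s'
    proof -
      obtain r where r: "0 < r" "\<gamma> s' = r *\<^sub>R \<gamma> s1" using c_eq[of s1 s'] s(1) s' by auto
      have "r \<noteq> 1"
      proof
        assume "r = 1"
        then have "\<gamma> s1 = \<gamma> s'" using r by simp
        then show False using inj_onD[OF inj] s(1) s'(1,2) by blast
      qed
      obtain b where b: "\<gamma> s' = v l + b *\<^sub>R d l" using point[OF l(1), of s'] l(2) by auto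
      have vl: "v l = r *\<^sub>R \<gamma> s1 - b *\<^sub>R d l" using b r(2) by simp
      have "r *\<^sub>R cross3 (v l - \<gamma> s1) (d l) = (r - 1) *\<^sub>R n l"
        unfolding n_def vl by (simp add: vec_eq_iff forall_3 cross_components algebra_simps)
      then have "(1 / r) *\<^sub>R r *\<^sub>R cross3 (v l - \<gamma> s1) (d l) = (1 / r) *\<^sub>R (r - 1) *\<^sub>R n l"
        by (rule arg_cong)
      then have "cross3 (v l - \<gamma> s1) (d l) = ((r - 1) / r) *\<^sub>R n l"
        using r(1) by simp
      then show ?thesis using \<open>r \<noteq> 1\<close> r by (intro exI[of _ "(r - 1) / r"] exI[of _ r]) auto
    qed
    obtain q2 r2 where 2: "q2 \<noteq> 0" "cross3 (v j - \<gamma> s1) (d j) = q2 *\<^sub>R n j" "r2 *\<^sub>R \<gamma> s1 = \<gamma> s2"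
      using ray[OF j s(2,4,7)] by blast
    obtain q3 r3 where 3: "q3 \<noteq> 0" "cross3 (v k - \<gamma> s1) (d k) = q3 *\<^sub>R n k" "r3 *\<^sub>R \<gamma> s1 = \<gamma> s3"
      using ray[OF k s(3,6,9)] by blast
    have "\<gamma> s2 \<noteq> 0" "\<gamma> s3 \<noteq> 0" using nz s(2,3) by auto
    then have r23: "r2 \<noteq> 0" "r3 \<noteq> 0" using 2(3) 3(3) by auto
    have "n j \<bullet> \<gamma> s2 = 0" "n k \<bullet> \<gamma> s3 = 0" using n\<gamma>[OF j(1), of s2] n\<gamma>[OF k(1), of s3] j k by auto
    then have "n j \<bullet> \<gamma> s1 = 0" "n k \<bullet> \<gamma> s1 = 0" using r23 by (simp_all flip: 2(3) 3(3))
    then obtain z where z: "\<gamma> s1 = z *\<^sub>R cross3 (n j) (n k)" using orthogonal_to_two[OF X] by blast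
    \<comment> \<open>The parameter at which the transversal through \<open>\<gamma> s1\<close>
      reaches the origin.\<close>
    define y where "y = - z / (q2 * q3)"
    have "\<gamma> s1 + y *\<^sub>R cross3 (cross3 (v j - \<gamma> s1) (d j)) (cross3 (v k - \<gamma> s1) (d k))
        = \<gamma> s1 + (y * q2 * q3) *\<^sub>R cross3 (n j) (n k)"
      unfolding 2(2) 3(2) by (simp add: cross_mult_left cross_mult_right)
    also have "y * q2 * q3 = - z" using 2(1) 3(1) by (simp add: y_def)
    also have "\<gamma> s1 + (- z) *\<^sub>R cross3 (n j) (n k) = 0" by (subst z) simp
    finally show False using no_trisecant[OF i(1) j(1) k(1), of a y] unfolding a by simp
  qed
  \<comment> \<open>Every double value lies on two great circles with independent normals, and there
    are finitely many pairs of edges.\<close>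
  have fin: "finite {y. card {s\<in>{0..<1}. c s = y} = 2}"
  proof (rule finite_subset)
    define I where "I = {p \<in> {..<m} \<times> {..<m}. cross3 (n (fst p)) (n (snd p)) \<noteq> 0}"
    show "finite (\<Union>p\<in>I. {y. norm y = 1 \<and> n (fst p) \<bullet> y = 0 \<and> n (snd p) \<bullet> y = 0})"
    proof (rule finite_UN_I)
      show "finite I" by (simp add: I_def)
    qed (simp add: I_def two_great_circles(1))
    show "{y. card {s\<in>{0..<1}. c s = y} = 2} \<subseteq>
      (\<Union>p\<in>I. {y. norm y = 1 \<and> n (fst p) \<bullet> y = 0 \<and> n (snd p) \<bullet> y = 0})"
    proof
      fix y assume "y \<in> {y. card {s\<in>{0..<1}. c s = y} = 2}"
      then obtain s s' where "{s\<in>{0..<1}. c s = y} = {s, s'}" "s \<noteq> s'" by (auto simp: card_2_iff)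
      then have s: "s \<in> {0..<1}" "s' \<in> {0..<1}" "s \<noteq> s'" "c s = y" "c s' = y" by blast+
      obtain k where k: "k < m" "s \<in> {t k<..<t (Suc k)}" using interior[of s s'] s by auto
      obtain l where l: "l < m" "s' \<in> {t l<..<t (Suc l)}" using interior[of s' s] s by auto
      have "(k, l) \<in> I" using cross[OF k l s(3)] s k l by (simp add: I_def)
      moreover have "norm y = 1" using nz[of s] s by (auto simp: c_def norm_radial)
      moreover have "n k \<bullet> c s = 0" "n l \<bullet> c s' = 0"
        using n\<gamma>[OF k(1), of s] n\<gamma>[OF l(1), of s'] k l nz[of s] nz[of s'] s(1,2)
        by (simp_all add: c_def inner_radial_eq_0_iff)
      then have "n k \<bullet> y = 0" "n l \<bullet> y = 0" unfolding s(4,5) .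
      ultimately show "y \<in> (\<Union>p\<in>I. {y. norm y = 1 \<and> n (fst p) \<bullet> y = 0 \<and> n (snd p) \<bullet> y = 0})"
        by (intro UN_I[of "(k, l)"]) auto
    qed
  qed
  have transversal: "\<not> (\<exists>N. N \<noteq> 0 \<and> radial ` closed_segment (v k) (v (Suc k)) \<union>
      radial ` closed_segment (v l) (v (Suc l)) \<subseteq> {x. N \<bullet> x = 0})"
    if k: "k < m" "s \<in> {t k<..<t (Suc k)}" and l: "l < m" "s' \<in> {t l<..<t (Suc l)}"
      and ne: "s \<noteq> s'" and eq: "c s = c s'" for k l s s'
  proof
    assume "\<exists>N. N \<noteq> 0 \<and> radial ` closed_segment (v k) (v (Suc k)) \<union>
      radial ` closed_segment (v l) (v (Suc l)) \<subseteq> {x. N \<bullet> x = 0}"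
    then obtain N where N: "N \<noteq> 0" "radial ` closed_segment (v k) (v (Suc k)) \<subseteq> {x. N \<bullet> x = 0}"
      "radial ` closed_segment (v l) (v (Suc l)) \<subseteq> {x. N \<bullet> x = 0}" by blast
    \<comment> \<open>A vector orthogonal to the radial image of an edge is orthogonal to both its
      endpoints, hence parallel to \<open>n j\<close>. A common \<open>N\<close> would thus make the
      two normals parallel.\<close>
    have multiple: "\<exists>q. n j = q *\<^sub>R N"
      if j: "j < m" and sub: "radial ` closed_segment (v j) (v (Suc j)) \<subseteq> {x. N \<bullet> x = 0}" for j
    proof -
      have "N \<bullet> radial (v j) = 0" "N \<bullet> radial (v (Suc j)) = 0" using sub by auto
      moreover have "v j \<noteq> 0" "v (Suc j) \<noteq> 0"
        using nz[of "t j"] nz[of "t (Suc j)"] t0[of j] t1[of j] t0[of "Suc j"] t1[of "Suc j"] j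
        by (auto simp: v_def)
      ultimately have "v j \<bullet> N = 0" "v (Suc j) \<bullet> N = 0"
        by (simp_all add: inner_radial_eq_0_iff inner_commute)
      then obtain q where q: "N = q *\<^sub>R n j"
        using orthogonal_to_two[of "v j" "v (Suc j)" N] n0[OF j] unfolding n_alt by blast
      then have "q \<noteq> 0" using N(1) by auto
      then have "n j = (1 / q) *\<^sub>R N" using q by simp
      then show ?thesis ..
    qed
    obtain q q' where "n k = q *\<^sub>R N" "n l = q' *\<^sub>R N"
      using multiple[OF k(1) N(2)] multiple[OF l(1) N(3)] by blast
    then have "cross3 (n k) (n l) = 0" by (simp add: cross_mult_left cross_mult_right)
    then show False using cross[OF k l ne eq] by blast
  qed
  have nz0: "0 \<notin> \<gamma> ` {0..1}" using nz by force
  show ?thesis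
    unfolding has_sps_diagram_def
  proof (rule exI[of _ \<gamma>], rule exI[of _ t], rule exI[of _ "\<lambda>k. radial ` closed_segment (v k) (v (Suc k))"],
      unfold Let_def, fold c_def, intro conjI)
    show "\<forall>i<m. t i < t (Suc i)" using t(3) by blast
    show "\<forall>i<m. great_arc (radial ` closed_segment (v i) (v (Suc i))) \<and> inj_on c {t i..t (Suc i)} \<and>
        c ` {t i..t (Suc i)} = radial ` closed_segment (v i) (v (Suc i))"
      using A injc cim by blast
    show "\<forall>y. finite {s\<in>{0..<1}. c s = y} \<and> card {s\<in>{0..<1}. c s = y} \<le> 2" using fib by blast
    show "\<forall>i\<le>m. card {s\<in>{0..<1}. c s = c (t i)} = 1" using single by blast
    show "\<forall>i<m. \<forall>j<m. \<forall>s\<in>{t i<..<t (Suc i)}. \<forall>s'\<in>{t j<..<t (Suc j)}. s \<noteq> s' \<and> c s = c s' \<longrightarrow>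
        \<not> (\<exists>N. N \<noteq> 0 \<and> radial ` closed_segment (v i) (v (Suc i)) \<union>
          radial ` closed_segment (v j) (v (Suc j)) \<subseteq> {x. N \<bullet> x = 0})"
      by (intro allI ballI impI, elim conjE) (rule transversal)
  qed (fact cont loop inj nz0 iso t fin)+
qed

text \<open>Each condition keeps \<open>p\<close> off a surface parametrised by \<open>x\<close> and
  \<open>y\<close>. There are finitely many of these surfaces, all of measure zero, so they do not
  fill the space.\<close>

lemma generic_viewpoint:
  fixes v d :: "nat \<Rightarrow> R3"
  obtains p where "\<And>k l x y. k < m \<Longrightarrow> l \<le> m \<Longrightarrow> v k + x *\<^sub>R d k + y *\<^sub>R (v l - v k) \<noteq> p"
    "\<And>i j k x y. i < m \<Longrightarrow> j < m \<Longrightarrow> k < m \<Longrightarrow>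
      v i + x *\<^sub>R d i + y *\<^sub>R cross3 (cross3 (v j - (v i + x *\<^sub>R d i)) (d j)) (cross3 (v k - (v i + x *\<^sub>R d i)) (d k)) \<noteq> p"
proof -
  define S1 where "S1 q = range (\<lambda>(x, y). v (fst q) + x *\<^sub>R d (fst q) + y *\<^sub>R (v (snd q) - v (fst q)))" for q
  define S2 where "S2 q = (case q of (i, j, k) \<Rightarrow> range (\<lambda>(x, y). v i + x *\<^sub>R d i +
    y *\<^sub>R cross3 (cross3 (v j - (v i + x *\<^sub>R d i)) (d j)) (cross3 (v k - (v i + x *\<^sub>R d i)) (d k))))" for q
  have "negligible (S1 q)" for q
    using negligible_polynomial_surface[of "v (fst q)" "d (fst q)" "v (snd q) - v (fst q)" 0 0]
    by (simp add: S1_def)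
  moreover have "negligible (S2 q)" for q
  proof -
    obtain i j k where q: "q = (i, j, k)" by (cases q) auto
    \<comment> \<open>Both inner cross products are affine in \<open>x\<close>, so the outer one is
      quadratic in \<open>x\<close> with constant vectors as coefficients, as
      \<open>negligible_polynomial_surface\<close> requires.\<close>
    define b b' where "b = cross3 (v j - v i) (d j)" and "b' = cross3 (d i) (d j)"
    define e e' where "e = cross3 (v k - v i) (d k)" and "e' = cross3 (d i) (d k)"
    have "cross3 (cross3 (v j - (v i + x *\<^sub>R d i)) (d j)) (cross3 (v k - (v i + x *\<^sub>R d i)) (d k))
        = cross3 b e + x *\<^sub>R (- cross3 b e' - cross3 b' e) + (x * x) *\<^sub>R cross3 b' e'" for x
    proof -
      have eqs: "cross3 (v j - (v i + x *\<^sub>R d i)) (d j) = b - x *\<^sub>R b'"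
        "cross3 (v k - (v i + x *\<^sub>R d i)) (d k) = e - x *\<^sub>R e'"
        by (simp_all add: b_def b'_def e_def e'_def vec_eq_iff forall_3 cross_components algebra_simps)
      show ?thesis
        unfolding eqs by (simp add: vec_eq_iff forall_3 cross_components algebra_simps)
    qed
    then have "S2 q = range (\<lambda>(x, y). v i + x *\<^sub>R d i + y *\<^sub>R cross3 b e +
        (x * y) *\<^sub>R (- cross3 b e' - cross3 b' e) + (x * x * y) *\<^sub>R cross3 b' e')"
      unfolding S2_def q by (simp add: scaleR_add_right mult.commute add.assoc)
    then show ?thesis by (simp only: negligible_polynomial_surface)
  qed
  ultimately have "negligible (\<Union> (S1 ` ({..<m} \<times> {..m})) \<union> \<Union> (S2 ` ({..<m} \<times> {..<m} \<times> {..<m})))"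
    by (intro negligible_Un negligible_Union) auto
  then have "\<Union> (S1 ` ({..<m} \<times> {..m})) \<union> \<Union> (S2 ` ({..<m} \<times> {..<m} \<times> {..<m})) \<noteq> UNIV"
    using non_negligible_UNIV by metis
  then obtain p where p: "p \<notin> \<Union> (S1 ` ({..<m} \<times> {..m}))"
    "p \<notin> \<Union> (S2 ` ({..<m} \<times> {..<m} \<times> {..<m}))" by blast
  show thesis
  proof (rule that[of p])
    fix k l x y assume "k < m" "l \<le> m"
    then have "p \<notin> S1 (k, l)" using p(1) by blast
    then show "v k + x *\<^sub>R d k + y *\<^sub>R (v l - v k) \<noteq> p" by (force simp: S1_def)
  next
    fix i j k x y assume "i < m" "j < m" "k < m"
    then have "p \<notin> S2 (i, j, k)" using p(2) by blast
    then show "v i + x *\<^sub>R d i + y *\<^sub>R cross3 (cross3 (v j - (v i + x *\<^sub>R d i)) (d j))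
        (cross3 (v k - (v i + x *\<^sub>R d i)) (d k)) \<noteq> p"
      by (force simp: S2_def)
  qed
qed

text \<open>Translating a generic viewpoint \<open>p\<close> to the origin is an isotopy, and the
  conditions on \<open>p\<close> become the genericity conditions at the origin.\<close>

lemma tame_knot_has_sps_diagram:
  assumes "tame_knot K"
  shows "\<exists>n. has_sps_diagram K n"
proof -
  obtain vs where vs: "polygonal_knot vs" "ambient_isotopic K (polygon vs)"
    using assms unfolding tame_knot_def by blast
  then have "knot (polygon vs)" by (simp add: polygonal_knot_def)
  then obtain \<gamma> :: "real \<Rightarrow> R3" and m t where
    \<gamma>: "continuous_on {0..1} \<gamma>" "\<gamma> 0 = \<gamma> 1" "inj_on \<gamma> {0..<1}" "\<gamma> ` {0..1} = polygon vs"
    and t: "t 0 = 0" "t m = 1" "\<And>k. k < m \<Longrightarrow> t k < t (Suc k)"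
    and inj: "\<And>k. k < m \<Longrightarrow> inj_on \<gamma> {t k..t (Suc k)}"
    and seg: "\<And>k. k < m \<Longrightarrow> \<exists>a b. \<gamma> ` {t k..t (Suc k)} \<subseteq> closed_segment a b"
    by (rule polygon_loop_partition) (rule that)
  \<comment> \<open>Inclusion in some segment improves to equality with the segment between the end
    values, because an injective path in a line covers exactly that.\<close>
  have edge: "\<gamma> ` {t k..t (Suc k)} = closed_segment (\<gamma> (t k)) (\<gamma> (t (Suc k)))" if k: "k < m" for k
  proof -
    obtain a b where ab: "\<gamma> ` {t k..t (Suc k)} \<subseteq> closed_segment a b" using seg[OF k] by blast
    have line: "\<exists>r. \<gamma> s = a + r *\<^sub>R (b - a)" if "s \<in> {t k..t (Suc k)}" for s
    proof -
      have "\<gamma> s \<in> closed_segment a b" using ab that by blast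
      then obtain r where "\<gamma> s = (1 - r) *\<^sub>R a + r *\<^sub>R b" by (auto simp: closed_segment_def)
      then have "\<gamma> s = a + r *\<^sub>R (b - a)" by (simp add: algebra_simps)
      then show ?thesis ..
    qed
    have tlt: "t i < t j" if "i < j" "j \<le> m" for i j
      using partition_strict_mono[of m t i j] t(3) that by blast
    have "0 \<le> t k" "t (Suc k) \<le> 1"
      using tlt[of 0 k] tlt[of "Suc k" m] t k by (cases "k = 0"; cases "Suc k = m"; force)+
    then have "continuous_on {t k..t (Suc k)} \<gamma>" by (intro continuous_on_subset[OF \<gamma>(1)]) auto
    from injective_collinear_param[OF t(3)[OF k] this inj[OF k] line]
    obtain l where l: "l ` {t k..t (Suc k)} = {0..1}"
      "\<And>s. s \<in> {t k..t (Suc k)} \<Longrightarrow> \<gamma> s = \<gamma> (t k) + l s *\<^sub>R (\<gamma> (t (Suc k)) - \<gamma> (t k))"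
      by (smt (verit))
    then show ?thesis by (rule image_eq_closed_segment)
  qed
  define v where "v k = \<gamma> (t k)" for k
  define d where "d k = v (Suc k) - v k" for k
  obtain p where p1: "\<And>k l x y. k < m \<Longrightarrow> l \<le> m \<Longrightarrow> v k + x *\<^sub>R d k + y *\<^sub>R (v l - v k) \<noteq> p"
    and p2: "\<And>i j k x y. i < m \<Longrightarrow> j < m \<Longrightarrow> k < m \<Longrightarrow>
      v i + x *\<^sub>R d i + y *\<^sub>R cross3 (cross3 (v j - (v i + x *\<^sub>R d i)) (d j)) (cross3 (v k - (v i + x *\<^sub>R d i)) (d k)) \<noteq> p"
    by (rule generic_viewpoint[of m v d]) (rule that)
  define \<gamma>' where "\<gamma>' s = \<gamma> s + - p" for s
  have v': "\<gamma>' (t k) = v k - p" "v (Suc k) - p - (v k - p) = d k" for k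
    by (simp_all add: \<gamma>'_def d_def v_def)
  have injp: "inj_on \<gamma>' S \<longleftrightarrow> inj_on \<gamma> S" for S by (simp add: inj_on_def \<gamma>'_def)
  have "has_sps_diagram K m"
  proof (rule has_sps_diagram_generic_viewpoint[of \<gamma>' t m K], unfold v' injp)
    show "continuous_on {0..1} \<gamma>'" unfolding \<gamma>'_def by (intro continuous_intros \<gamma>)
    show "\<gamma>' 0 = \<gamma>' 1" by (simp add: \<gamma>'_def \<gamma>)
    show "ambient_isotopic K (\<gamma>' ` {0..1})"
    proof -
      have "\<gamma>' ` {0..1} = (\<lambda>x. x + - p) ` polygon vs"
        unfolding \<gamma>(4)[symmetric] image_image \<gamma>'_def ..
      then show ?thesis by (simp only: ambient_isotopic_trans[OF vs(2) ambient_isotopic_translation])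
    qed
    show "\<gamma>' ` {t k..t (Suc k)} = closed_segment (v k - p) (v (Suc k) - p)" if k: "k < m" for k
    proof -
      have "\<gamma>' ` {t k..t (Suc k)} = (\<lambda>x. - p + x) ` \<gamma> ` {t k..t (Suc k)}"
        unfolding image_image \<gamma>'_def by (rule image_cong) auto
      also have "\<dots> = closed_segment (- p + v k) (- p + v (Suc k))"
        unfolding edge[OF k] v_def closed_segment_translation ..
      finally show ?thesis by simp
    qed
    show "v k - p + x *\<^sub>R d k + y *\<^sub>R (v l - p - (v k - p)) \<noteq> 0" if "k < m" "l \<le> m" for k l x y
      using p1[OF that, of x y] by (simp add: algebra_simps)
    fix i j k x y assume ijk: "i < m" "j < m" "k < m"
    have "v j - p - (v i - p + x *\<^sub>R d i) = v j - (v i + x *\<^sub>R d i)" for j by simp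
    then show "v i - p + x *\<^sub>R d i + y *\<^sub>R cross3 (cross3 (v j - p - (v i - p + x *\<^sub>R d i)) (d j))
        (cross3 (v k - p - (v i - p + x *\<^sub>R d i)) (d k)) \<noteq> 0"
      using p2[OF ijk, of x y] by (simp add: algebra_simps)
  qed (fact \<gamma>(3) t inj)+
  then show ?thesis ..
qed

theorem theorem3p4:
  fixes K :: "(real^3) set"
  assumes "tame_knot K" and "\<not> unknot K"
  shows "1 + sqrt (1 + real (crossing_number K)) \<le> real (sps K)"
proof -
  have "has_sps_diagram K (sps K)"
    unfolding sps_def using tame_knot_has_sps_diagram[OF assms(1)] by (rule LeastI_ex)
  then have n: "2 \<le> sps K" and "\<exists>m \<le> sps K * (sps K - 2). has_diagram K m"
    by (rule has_sps_diagram_imp_has_diagram)+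
  then obtain m where m: "m \<le> sps K * (sps K - 2)" "has_diagram K m" by blast
  have "crossing_number K \<le> m"
    unfolding crossing_number_def using m(2) by (rule Least_le)
  then have "crossing_number K \<le> sps K * (sps K - 2)" using m(1) by (rule order_trans)
  then have "real (crossing_number K) \<le> real (sps K * (sps K - 2))" by (simp only: of_nat_le_iff)
  \<comment> \<open>Here \<open>2 \<le> sps K\<close> makes the subtraction of natural numbers a
    genuine one; below it also makes \<open>sps K - 1\<close> nonnegative for taking the square
    root.\<close>
  also have "\<dots> = real (sps K) * (real (sps K) - 2)" using n by (simp add: of_nat_diff)
  finally have "1 + real (crossing_number K) \<le> (real (sps K) - 1)\<^sup>2"
    by (simp add: power2_eq_square algebra_simps)
  then have "sqrt (1 + real (crossing_number K)) \<le> real (sps K) - 1"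
    using n by (intro real_le_lsqrt) auto
  then show ?thesis by simp
qed


end
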